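(* Let $K$ be a field, $R=K[[t_1,\ldots,t_m]]$, let $>$ be a $\underline{t}$-local monomial ordering on $\mathrm{Mon}^s(\underline{t},\underline{x})$, let $I\leq R[\underline{x}]^s$ be an $R[\underline{x}]$-submodule and $g_1,\ldots,g_k\in I$. Then the following statements are equivalent: (a) $G=(g_1,\ldots,g_k)$ is a standard basis of $I$. (b) Every weak normal form with respect to $G$ of any element of $I$ is zero. (c) Every element of $I$ has a weak standard representation with respect to $G$. (d) $\langle I\rangle_{R[\underline{x}]_>}=\langle G\rangle_{R[\underline{x}]_>}$ and $\mathrm{spoly}(g_i,g_j)$ has a weak standard representation with respect to $G$ for all $i<j$.
   Context: $R[\underline{x}]=K[[t_1,\ldots,t_m]][x_1,\ldots,x_n]$ is the polynomial ring in $\underline{x}=(x_1,\ldots,x_n)$ over the formal power series ring $R$ in $\underline{t}=(t_1,\ldots,t_m)$. $\mathrm{Mon}(\underline{t},\underline{x})=\{\underline{t}^\alpha\underline{x}^\beta\mid\alpha\in\mathbb{N}^m,\beta\in\mathbb{N}^n\}$ and $\mathrm{Mon}^s(\underline{t},\underline{x})=\{\underline{t}^\alpha\underline{x}^\beta e_i\mid \alpha\in\mathbb{N}^m,\beta\in\mathbb{N}^n,1\le i\le s\}$, with $e_i$ the $i$-th unit vector. A module monomial $p$ divides $p'$ if $p'=\underline{t}^\alpha\underline{x}^\beta p$ for some $\alpha,\beta$; $\mathrm{lcm}(p,p')$ is the usual least common multiple if $p,p'$ involve the same $e_i$, and $0$ otherwise. A monomial ordering on $\mathrm{Mon}(\underline{t},\underline{x})$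 is a total ordering compatible with multiplication. A monomial ordering on $\mathrm{Mon}^s(\underline{t},\underline{x})$ is a total ordering $>$ such that $p>p'$ implies $\underline{t}^\alpha\underline{x}^\beta p>\underline{t}^\alpha\underline{x}^\beta p'$ for all $\alpha,\beta$, and for which there is a monomial ordering on $\mathrm{Mon}(\underline{t},\underline{x})$ (the induced one, also denoted $>$) such that $\underline{t}^\alpha\underline{x}^\beta>\underline{t}^{\alpha'}\underline{x}^{\beta'}\Leftrightarrow\underline{t}^\alpha\underline{x}^\beta e_i>\underline{t}^{\alpha'}\underline{x}^{\beta'}e_i$ for each $i$. It is $\underline{t}$-local if $t_i<1$ for all $i=1,\ldots,m$ in the induced ordering. For $0\ne f\in R[\underline{x}]^s$, $\mathrm{lm}_>(f)$ is the largest monomial occurring in $f$ with non-zero coefficient and $\mathrm{lt}_>(f)$ the corresponding term including its coefficient; $\mathrm{lm}_>(0)=\mathrm{lt}_>(0)=0$, and $0$ is regarded as smaller than every monomial and as dividing no monomial. $S_>=\{u\in R[\underline{x}]\mid\mathrm{lt}_>(u)=1\}$ and $R[\underline{x}]_>=S_>^{-1}R[\underline{x}]$. For $G\subseteq R[\underline{x}]^s$ let $L_>(G)=\langle\mathrm{lm}_>(g)\mid g\in G\rangle\leq K[\underline{t},\underline{x}]^s$ (a $K[\underline{t},\underline{x}]$-module). A standard basis of $I$ is a finite $G\subset I$ with $L_>(G)=L_>(I)$. A weak division with remainder of $f\in R[\underline{x}]^s$ with respect to $(g_1,\ldots,g_k)$ is a representation $u f=q_1g_1+\ldots+q_kg_k+r$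 with $u\in S_>$, $q_i\in R[\underline{x}]$, $r\in R[\underline{x}]^s$ such that $\mathrm{lm}_>(f)\ge\mathrm{lm}_>(q_ig_i)$ for all $i$, and, unless $r=0$, $\mathrm{lm}_>(g_i)\nmid\mathrm{lm}_>(r)$ for all $i$. Then $r$ is called a weak normal form of $f$; if $r=0$ the representation is called a weak standard representation of $f$. For non-zero $f,g$: $\mathrm{spoly}(f,g)=\frac{\mathrm{lcm}(\mathrm{lm}_>(f),\mathrm{lm}_>(g))}{\mathrm{lt}_>(f)}f-\frac{\mathrm{lcm}(\mathrm{lm}_>(f),\mathrm{lm}_>(g))}{\mathrm{lt}_>(g)}g$; put $\mathrm{spoly}(f,g)=0$ if $f=0$ or $g=0$. *)

theory Defs
  imports
    "HOL.Hull"
    "HOL-Library.Poly_Mapping"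
    "HOL-Library.Product_Plus"
    "HOL-Library.Function_Algebras"
    "HOL-Computational_Algebra.Fraction_Field"
begin

section \<open>Multivariate formal power series\<close>

abbreviation (input) "keys \<equiv> Poly_Mapping.keys"
abbreviation (input) "lookup \<equiv> Poly_Mapping.lookup"

text \<open>An exponent \<open>\<alpha>\<close> is a finitely supported function; addition is multiplication of monomials,
  and subtraction is pointwise truncated subtraction.\<close>

type_synonym expo = "nat \<Rightarrow>\<^sub>0 nat"

text \<open>Formal power series in the variables \<open>t\<^sub>0, t\<^sub>1, \<dots>\<close>: arbitrary coefficient functions on the
  exponents. The series in finitely many variables form the subring \<open>PS m\<close> below.\<close>

typedef 'a mfps = "UNIV :: (expo \<Rightarrow> 'a) set"
  morphisms mfps_nth Abs_mfps ..

lemma mfps_nth_Abs [simp]: "mfps_nth (Abs_mfps f) = f"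
  by (simp add: Abs_mfps_inverse)

lemma mfps_eqI: "(\<And>\<alpha>. mfps_nth f \<alpha> = mfps_nth g \<alpha>) \<Longrightarrow> f = g"
  by (rule iffD1[OF mfps_nth_inject], rule ext)

lemma mfps_eq_iff: "f = g \<longleftrightarrow> (\<forall>\<alpha>. mfps_nth f \<alpha> = mfps_nth g \<alpha>)"
  by (auto intro: mfps_eqI)

lemma lookup_le_of_add: "\<alpha> + \<beta> = \<gamma> \<Longrightarrow> lookup \<alpha> k \<le> lookup (\<gamma> :: expo) k"
  by (auto simp: lookup_add)

lemma keys_add_expo: "keys (\<alpha> + \<beta>) = keys \<alpha> \<union> keys (\<beta> :: expo)"
  by (auto simp: in_keys_iff lookup_add)

lemma finite_bounded_expos:
  assumes "finite N"
  shows "finite {\<alpha> :: expo. keys \<alpha> \<subseteq> N \<and> (\<forall>k\<in>N. lookup \<alpha> k \<le> b)}"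
proof -
  have "lookup ` {\<alpha> :: expo. keys \<alpha> \<subseteq> N \<and> (\<forall>k\<in>N. lookup \<alpha> k \<le> b)}
      \<subseteq> {h. \<forall>x. (x \<in> N \<longrightarrow> h x \<in> {..b}) \<and> (x \<notin> N \<longrightarrow> h x = 0)}"
    by (auto simp: in_keys_iff subset_iff)
  moreover have "finite {h. \<forall>x. (x \<in> N \<longrightarrow> h x \<in> {..b}) \<and> (x \<notin> N \<longrightarrow> h x = (0::nat))}"
    by (rule finite_set_of_finite_funs) (use assms in auto)
  ultimately have "finite (lookup ` {\<alpha> :: expo. keys \<alpha> \<subseteq> N \<and> (\<forall>k\<in>N. lookup \<alpha> k \<le> b)})"
    by (rule finite_subset)
  then show ?thesis
    by (rule finite_imageD) (auto intro!: inj_onI poly_mapping_eqI)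
qed

lemma finite_summands: "finite {\<alpha> :: expo. \<exists>\<beta>. \<alpha> + \<beta> = \<gamma>}"
proof -
  define b where "b = (\<Sum>k\<in>keys \<gamma>. lookup \<gamma> k)"
  have "keys \<alpha> \<subseteq> keys \<gamma> \<and> (\<forall>k\<in>keys \<gamma>. lookup \<alpha> k \<le> b)" if eq: "\<alpha> + \<beta> = \<gamma>" for \<alpha> \<beta>
  proof (intro conjI ballI)
    show "keys \<alpha> \<subseteq> keys \<gamma>"
      using keys_add_expo[of \<alpha> \<beta>] eq by blast
  next
    fix k assume "k \<in> keys \<gamma>"
    then have "lookup \<gamma> k \<le> b"
      unfolding b_def by (intro member_le_sum) simp_all
    then show "lookup \<alpha> k \<le> b"
      using lookup_le_of_add[OF eq, of k] by linarith
  qed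
  then have "{\<alpha>. \<exists>\<beta>. \<alpha> + \<beta> = \<gamma>} \<subseteq> {\<alpha>. keys \<alpha> \<subseteq> keys \<gamma> \<and> (\<forall>k\<in>keys \<gamma>. lookup \<alpha> k \<le> b)}"
    by blast
  then show ?thesis
    by (rule finite_subset) (rule finite_bounded_expos[OF finite_keys])
qed

lemma finite_decompositions [simp]: "finite {(\<alpha>, \<beta>). \<alpha> + \<beta> = (\<gamma> :: expo)}"
proof (rule finite_subset)
  show "{(\<alpha>, \<beta>). \<alpha> + \<beta> = \<gamma>} \<subseteq> {\<alpha> :: expo. \<exists>\<beta>. \<alpha> + \<beta> = \<gamma>} \<times> {\<beta> :: expo. \<exists>\<alpha>. \<beta> + \<alpha> = \<gamma>}"
  proof safe
    fix \<alpha> \<beta> :: expo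
    show "\<exists>\<beta>'. \<alpha> + \<beta>' = \<alpha> + \<beta>" by (rule exI, rule refl)
    show "\<exists>\<alpha>'. \<beta> + \<alpha>' = \<alpha> + \<beta>" by (rule exI, rule add.commute)
  qed
qed (rule finite_cartesian_product[OF finite_summands finite_summands])

instantiation mfps :: (zero) zero
begin
definition zero_mfps :: "'a mfps" where "0 = Abs_mfps (\<lambda>_. 0)"
instance ..
end

instantiation mfps :: (zero_neq_one) one
begin
definition one_mfps :: "'a mfps" where "1 = Abs_mfps (\<lambda>\<alpha>. if \<alpha> = 0 then 1 else 0)"
instance ..
end

instantiation mfps :: (plus) plus
begin
definition plus_mfps :: "'a mfps \<Rightarrow> 'a mfps \<Rightarrow> 'a mfps"
  where "f + g = Abs_mfps (\<lambda>\<alpha>. mfps_nth f \<alpha> + mfps_nth g \<alpha>)"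
instance ..
end

instantiation mfps :: (minus) minus
begin
definition minus_mfps :: "'a mfps \<Rightarrow> 'a mfps \<Rightarrow> 'a mfps"
  where "f - g = Abs_mfps (\<lambda>\<alpha>. mfps_nth f \<alpha> - mfps_nth g \<alpha>)"
instance ..
end

instantiation mfps :: (uminus) uminus
begin
definition uminus_mfps :: "'a mfps \<Rightarrow> 'a mfps"
  where "- f = Abs_mfps (\<lambda>\<alpha>. - mfps_nth f \<alpha>)"
instance ..
end

instantiation mfps :: (comm_semiring_0) times
begin
definition times_mfps :: "'a mfps \<Rightarrow> 'a mfps \<Rightarrow> 'a mfps"
  where "f * g = Abs_mfps (\<lambda>\<gamma>. \<Sum>(\<alpha>, \<beta>) | \<alpha> + \<beta> = \<gamma>. mfps_nth f \<alpha> * mfps_nth g \<beta>)"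
instance ..
end

lemma mfps_nth_simps [simp]:
  "mfps_nth 0 \<alpha> = 0"
  "mfps_nth 1 \<alpha> = (if \<alpha> = 0 then 1 else 0)"
  "mfps_nth (f + g) \<alpha> = mfps_nth f \<alpha> + mfps_nth g \<alpha>"
  "mfps_nth (f - g) \<alpha> = mfps_nth f \<alpha> - mfps_nth g \<alpha>"
  "mfps_nth (- f) \<alpha> = - mfps_nth f \<alpha>"
  by (simp_all add: zero_mfps_def one_mfps_def plus_mfps_def minus_mfps_def uminus_mfps_def)

lemma mfps_nth_mult:
  "mfps_nth (f * g) \<gamma> = (\<Sum>(\<alpha>, \<beta>) | \<alpha> + \<beta> = \<gamma>. mfps_nth f \<alpha> * mfps_nth g \<beta>)"
  by (simp add: times_mfps_def)

instance mfps :: (comm_ring_1) comm_ring_1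
proof
  fix f g h :: "'a mfps"
  show "f * g * h = f * (g * h)"
  proof (rule mfps_eqI)
    fix \<gamma>
    have "mfps_nth (f * g * h) \<gamma> = (\<Sum>(p, c)\<in>{(p, c). p + c = \<gamma>}. \<Sum>(a, b)\<in>{(a, b). a + b = p}.
        mfps_nth f a * mfps_nth g b * mfps_nth h c)"
      by (simp add: mfps_nth_mult sum_distrib_right case_prod_unfold)
    also have "\<dots> = (\<Sum>((p, c), (a, b))\<in>(SIGMA (p, c):{(p, c). p + c = \<gamma>}. {(a, b). a + b = p}).
        mfps_nth f a * mfps_nth g b * mfps_nth h c)"
      by (subst sum.Sigma[symmetric]) (auto simp: case_prod_unfold intro: finite_decompositions[unfolded case_prod_unfold])
    also have "\<dots> = (\<Sum>((a, p), (b, c))\<in>(SIGMA (a, p):{(a, p). a + p = \<gamma>}. {(b, c). b + c = p}).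
        mfps_nth f a * (mfps_nth g b * mfps_nth h c))"
      by (rule sum.reindex_bij_witness[where i = "\<lambda>((a, p), (b, c)). ((a + b, c), (a, b))"
            and j = "\<lambda>((p, c), (a, b)). ((a, b + c), (b, c))"])
        (auto simp: add.assoc mult.assoc)
    also have "\<dots> = (\<Sum>(a, p)\<in>{(a, p). a + p = \<gamma>}. \<Sum>(b, c)\<in>{(b, c). b + c = p}.
        mfps_nth f a * (mfps_nth g b * mfps_nth h c))"
      by (subst sum.Sigma[symmetric]) (auto simp: case_prod_unfold intro: finite_decompositions[unfolded case_prod_unfold])
    also have "\<dots> = mfps_nth (f * (g * h)) \<gamma>"
      by (simp add: mfps_nth_mult sum_distrib_left case_prod_unfold)
    finally show "mfps_nth (f * g * h) \<gamma> = mfps_nth (f * (g * h)) \<gamma>" .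
  qed
  show "f * g = g * f"
    by (rule mfps_eqI, unfold mfps_nth_mult,
        rule sum.reindex_bij_witness[where i = prod.swap and j = prod.swap])
      (auto simp: add.commute mult.commute)
  show "1 * f = f"
  proof (rule mfps_eqI)
    fix \<gamma>
    have "mfps_nth (1 * f) \<gamma> = (\<Sum>(\<alpha>, \<beta>)\<in>{(0, \<gamma>)}. mfps_nth 1 \<alpha> * mfps_nth f \<beta>)"
      unfolding mfps_nth_mult by (rule sum.mono_neutral_right) (auto split: if_splits)
    then show "mfps_nth (1 * f) \<gamma> = mfps_nth f \<gamma>" by simp
  qed
  show "(f + g) * h = f * h + g * h"
    by (rule mfps_eqI)
      (simp add: mfps_nth_mult case_prod_unfold sum.distrib distrib_right)
  show "(0 :: 'a mfps) \<noteq> 1"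
    by (auto simp: mfps_eq_iff)
qed (auto intro!: mfps_eqI simp: algebra_simps)

lemma exists_least_exponent:
  assumes "finite N" "\<alpha>0 \<in> A" "keys (\<alpha>0 :: expo) \<subseteq> N"
  obtains \<alpha> where "\<alpha> \<in> A" "keys \<alpha> \<subseteq> N"
    "\<And>a. a \<in> A \<Longrightarrow> keys a \<subseteq> N \<Longrightarrow> sum (lookup \<alpha>) N \<le> sum (lookup a) N"
    "\<And>a. a \<in> A \<Longrightarrow> keys a \<subseteq> N \<Longrightarrow> sum (lookup a) N = sum (lookup \<alpha>) N \<Longrightarrow> \<alpha> \<le> a"
proof -
  let ?B = "{a \<in> A. keys a \<subseteq> N}"
  obtain b where b: "b \<in> ?B" "\<And>a. a \<in> ?B \<Longrightarrow> sum (lookup b) N \<le> sum (lookup a) N"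
    using ex_has_least_nat[of "\<lambda>a. a \<in> ?B" \<alpha>0 "\<lambda>a. sum (lookup a) N"] assms by blast
  let ?C = "{a \<in> ?B. sum (lookup a) N = sum (lookup b) N}"
  have "finite ?C"
  proof (rule finite_subset)
    show "?C \<subseteq> {a. keys a \<subseteq> N \<and> (\<forall>k\<in>N. lookup a k \<le> sum (lookup b) N)}"
    proof safe
      fix a k assume "sum (lookup a) N = sum (lookup b) N" "k \<in> N"
      then show "lookup a k \<le> sum (lookup b) N"
        using member_le_sum[of k N "lookup a"] assms(1) by simp
    qed
  qed (rule finite_bounded_expos[OF assms(1)])
  moreover have "?C \<noteq> {}" using b by auto
  ultimately have M: "Min ?C \<in> ?C" "\<And>a. a \<in> ?C \<Longrightarrow> Min ?C \<le> a"
    using Min_in Min_le by blast+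
  show thesis
    by (rule that[of "Min ?C"]) (use M b in auto)
qed

instance mfps :: (idom) idom
proof
  fix f g :: "'a mfps"
  assume "f \<noteq> 0" "g \<noteq> 0"
  then obtain \<alpha>0 \<beta>0 where nz: "mfps_nth f \<alpha>0 \<noteq> 0" "mfps_nth g \<beta>0 \<noteq> 0"
    by (auto simp: mfps_eq_iff)
  define N where "N = keys \<alpha>0 \<union> keys \<beta>0"
  have N: "finite N" "keys \<alpha>0 \<subseteq> N" "keys \<beta>0 \<subseteq> N" by (auto simp: N_def)
  obtain \<alpha> where \<alpha>: "mfps_nth f \<alpha> \<noteq> 0" "keys \<alpha> \<subseteq> N"
    "\<And>a. mfps_nth f a \<noteq> 0 \<Longrightarrow> keys a \<subseteq> N \<Longrightarrow> sum (lookup \<alpha>) N \<le> sum (lookup a) N"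
    "\<And>a. mfps_nth f a \<noteq> 0 \<Longrightarrow> keys a \<subseteq> N \<Longrightarrow> sum (lookup a) N = sum (lookup \<alpha>) N \<Longrightarrow> \<alpha> \<le> a"
    by (rule exists_least_exponent[of N \<alpha>0 "{a. mfps_nth f a \<noteq> 0}"]) (use N nz in auto)
  obtain \<beta> where \<beta>: "mfps_nth g \<beta> \<noteq> 0" "keys \<beta> \<subseteq> N"
    "\<And>a. mfps_nth g a \<noteq> 0 \<Longrightarrow> keys a \<subseteq> N \<Longrightarrow> sum (lookup \<beta>) N \<le> sum (lookup a) N"
    "\<And>a. mfps_nth g a \<noteq> 0 \<Longrightarrow> keys a \<subseteq> N \<Longrightarrow> sum (lookup a) N = sum (lookup \<beta>) N \<Longrightarrow> \<beta> \<le> a"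
    by (rule exists_least_exponent[of N \<beta>0 "{a. mfps_nth g a \<noteq> 0}"]) (use N nz in auto)
  have only: "(a, b) = (\<alpha>, \<beta>)"
    if ab: "a + b = \<alpha> + \<beta>" "mfps_nth f a \<noteq> 0" "mfps_nth g b \<noteq> 0" for a b
  proof -
    have "keys a \<union> keys b = keys \<alpha> \<union> keys \<beta>"
      using ab(1) by (metis keys_add_expo)
    then have k: "keys a \<subseteq> N" "keys b \<subseteq> N" using \<alpha>(2) \<beta>(2) by auto
    have "sum (lookup (a + b)) N = sum (lookup (\<alpha> + \<beta>)) N" using ab(1) by simp
    then have "sum (lookup a) N + sum (lookup b) N = sum (lookup \<alpha>) N + sum (lookup \<beta>) N"
      by (simp add: lookup_add sum.distrib)
    with \<alpha>(3)[OF ab(2) k(1)] \<beta>(3)[OF ab(3) k(2)]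
    have "sum (lookup a) N = sum (lookup \<alpha>) N" "sum (lookup b) N = sum (lookup \<beta>) N" by auto
    then have "\<alpha> \<le> a" "\<beta> \<le> b" using \<alpha>(4) \<beta>(4) ab k by auto
    with ab(1) show ?thesis
      by (metis add_less_le_mono add_le_cancel_left add_le_cancel_right antisym order.refl nless_le)
  qed
  have "mfps_nth (f * g) (\<alpha> + \<beta>) = (\<Sum>(a, b)\<in>{(\<alpha>, \<beta>)}. mfps_nth f a * mfps_nth g b)"
    unfolding mfps_nth_mult by (rule sum.mono_neutral_right) (use only in auto)
  then have "mfps_nth (f * g) (\<alpha> + \<beta>) \<noteq> 0" using \<alpha>(1) \<beta>(1) by simp
  then show "f * g \<noteq> 0" by auto
qed


section \<open>The ring \<open>R[x]\<close> and the module \<open>R[x]\<^sup>s\<close>\<close>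

text \<open>
  The type below is the polynomial ring in \<open>x\<^sub>0, x\<^sub>1, \<dots>\<close> over the power series in \<open>t\<^sub>0, t\<^sub>1, \<dots>\<close>.
  Since \<open>m\<close>, \<open>n\<close> and \<open>s\<close> may be any natural numbers (\<open>0\<close> included), they are parameters of carrier
  sets: variables and unit vectors are numbered from \<open>0\<close>, so \<open>t\<^sub>1, \<dots>, t\<^sub>m\<close> have the indices \<open>< m\<close>,
  \<open>x\<^sub>1, \<dots>, x\<^sub>n\<close> the indices \<open>< n\<close> and \<open>e\<^sub>1, \<dots>, e\<^sub>s\<close> the indices \<open>< s\<close>.
\<close>

type_synonym 'a psp = "expo \<Rightarrow>\<^sub>0 'a mfps"

text \<open>Vectors are functions on \<open>nat\<close> with pointwise addition, vanishing from index \<open>s\<close> on.\<close>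

type_synonym 'a psv = "nat \<Rightarrow> 'a psp"

definition Exp :: "nat \<Rightarrow> expo set"
  where "Exp m = {\<alpha>. keys \<alpha> \<subseteq> {..<m}}"

definition PS :: "nat \<Rightarrow> 'a::comm_ring_1 mfps set"
  where "PS m = {c. \<forall>\<alpha>. mfps_nth c \<alpha> \<noteq> 0 \<longrightarrow> \<alpha> \<in> Exp m}"

definition Rx :: "nat \<Rightarrow> nat \<Rightarrow> 'a::comm_ring_1 psp set"
  where "Rx m n = {u. keys u \<subseteq> Exp n \<and> (\<forall>\<beta>. lookup u \<beta> \<in> PS m)}"

definition Rxs :: "nat \<Rightarrow> nat \<Rightarrow> nat \<Rightarrow> 'a::comm_ring_1 psv set"
  where "Rxs m n s = {f. (\<forall>i<s. f i \<in> Rx m n) \<and> (\<forall>i\<ge>s. f i = 0)}"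

text \<open>\<open>K[t,x]\<close>, as a subring of \<open>R[x]\<close>\<close>

definition Ktx :: "nat \<Rightarrow> nat \<Rightarrow> 'a::comm_ring_1 psp set"
  where "Ktx m n = {u \<in> Rx m n. \<forall>\<beta>. finite {\<alpha>. mfps_nth (lookup u \<beta>) \<alpha> \<noteq> 0}}"

definition smult_vec :: "'b::comm_ring_1 \<Rightarrow> (nat \<Rightarrow> 'b) \<Rightarrow> (nat \<Rightarrow> 'b)"  (infixr "\<odot>" 75)
  where "u \<odot> f = (\<lambda>i. u * f i)"

text \<open>\<open>M\<close> is a submodule over the subring \<open>A\<close>; \<open>(submodule_over A) hull B\<close> is the \<open>A\<close>-submodule
  generated by \<open>B\<close>.\<close>

definition submodule_over :: "'b::comm_ring_1 set \<Rightarrow> (nat \<Rightarrow> 'b) set \<Rightarrow> bool"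
  where "submodule_over A M \<longleftrightarrow>
    0 \<in> M \<and> (\<forall>f\<in>M. \<forall>g\<in>M. f + g \<in> M) \<and> (\<forall>a\<in>A. \<forall>f\<in>M. a \<odot> f \<in> M)"


section \<open>Monomials and monomial orderings\<close>

text \<open>\<open>(\<alpha>, \<beta>)\<close> stands for \<open>t\<^sup>\<alpha> x\<^sup>\<beta>\<close> and \<open>((\<alpha>, \<beta>), i)\<close> for \<open>t\<^sup>\<alpha> x\<^sup>\<beta> e\<^sub>i\<close>. Multiplication of monomials is
  addition of pairs.\<close>

type_synonym mon = "expo \<times> expo"
type_synonym mmon = "mon \<times> nat"

definition Mon :: "nat \<Rightarrow> nat \<Rightarrow> mon set"
  where "Mon m n = Exp m \<times> Exp n"

definition MMon :: "nat \<Rightarrow> nat \<Rightarrow> nat \<Rightarrow> mmon set"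
  where "MMon m n s = Mon m n \<times> {..<s}"

fun mon_act :: "mon \<Rightarrow> mmon \<Rightarrow> mmon"
  where "mon_act r (p, i) = (r + p, i)"

definition mmon_dvd :: "mmon \<Rightarrow> mmon \<Rightarrow> bool"
  where "mmon_dvd p p' \<longleftrightarrow> (\<exists>r. p' = mon_act r p)"

text \<open>Because subtraction is truncated, \<open>p + (q - p)\<close> is the pointwise maximum of the exponents.\<close>

definition mon_lcm :: "mon \<Rightarrow> mon \<Rightarrow> mon"
  where "mon_lcm p q = p + (q - p)"

text \<open>In the type \<open>mmon option\<close>, \<open>None\<close> plays the role of \<open>0\<close>.\<close>

fun mmon_lcm :: "mmon \<Rightarrow> mmon \<Rightarrow> mmon option"
  where "mmon_lcm (p, i) (q, j) = (if i = j then Some (mon_lcm p q, i) else None)"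

text \<open>Orderings are given by their strict relation: \<open>gt p q\<close> means \<open>p > q\<close>.\<close>

definition strict_total_on :: "'b set \<Rightarrow> ('b \<Rightarrow> 'b \<Rightarrow> bool) \<Rightarrow> bool"
  where "strict_total_on A gt \<longleftrightarrow> irreflp_on A gt \<and> transp_on A gt \<and> totalp_on A gt"

definition monomial_ordering :: "nat \<Rightarrow> nat \<Rightarrow> (mon \<Rightarrow> mon \<Rightarrow> bool) \<Rightarrow> bool"
  where "monomial_ordering m n gt \<longleftrightarrow>
    strict_total_on (Mon m n) gt \<and>
    (\<forall>p\<in>Mon m n. \<forall>q\<in>Mon m n. \<forall>r\<in>Mon m n. gt p q \<longrightarrow> gt (r + p) (r + q))"

text \<open>\<open>gt0\<close> is an induced ordering of \<open>gt\<close>; on \<open>Mon m n\<close> it is unique if \<open>s > 0\<close>.\<close>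

definition induced_ordering ::
    "nat \<Rightarrow> nat \<Rightarrow> nat \<Rightarrow> (mmon \<Rightarrow> mmon \<Rightarrow> bool) \<Rightarrow> (mon \<Rightarrow> mon \<Rightarrow> bool) \<Rightarrow> bool"
  where "induced_ordering m n s gt gt0 \<longleftrightarrow>
    monomial_ordering m n gt0 \<and>
    (\<forall>i<s. \<forall>p\<in>Mon m n. \<forall>q\<in>Mon m n. gt0 p q \<longleftrightarrow> gt (p, i) (q, i))"

definition module_monomial_ordering ::
    "nat \<Rightarrow> nat \<Rightarrow> nat \<Rightarrow> (mmon \<Rightarrow> mmon \<Rightarrow> bool) \<Rightarrow> bool"
  where "module_monomial_ordering m n s gt \<longleftrightarrow>
    strict_total_on (MMon m n s) gt \<and>
    (\<forall>p\<in>MMon m n s. \<forall>q\<in>MMon m n s. \<forall>r\<in>Mon m n. gt p q \<longrightarrow> gt (mon_act r p) (mon_act r q)) \<and>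
    (\<exists>gt0. induced_ordering m n s gt gt0)"

definition t_local :: "nat \<Rightarrow> (mon \<Rightarrow> mon \<Rightarrow> bool) \<Rightarrow> bool"
  where "t_local m gt0 \<longleftrightarrow> (\<forall>i<m. gt0 (0, 0) (Poly_Mapping.single i 1, 0))"


section \<open>Leading monomials\<close>

definition greatest_in :: "('b \<Rightarrow> 'b \<Rightarrow> bool) \<Rightarrow> 'b set \<Rightarrow> 'b"
  where "greatest_in gt A = (THE p. p \<in> A \<and> (\<forall>q\<in>A. q \<noteq> p \<longrightarrow> gt p q))"

fun psp_coeff :: "'a::comm_ring_1 psp \<Rightarrow> mon \<Rightarrow> 'a"
  where "psp_coeff u (\<alpha>, \<beta>) = mfps_nth (lookup u \<beta>) \<alpha>"

fun psv_coeff :: "'a::comm_ring_1 psv \<Rightarrow> mmon \<Rightarrow> 'a"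
  where "psv_coeff f (p, i) = psp_coeff (f i) p"

fun mon_term :: "mon \<Rightarrow> 'a::comm_ring_1 \<Rightarrow> 'a psp"
  where "mon_term (\<alpha>, \<beta>) c = Poly_Mapping.single \<beta> (Abs_mfps (\<lambda>\<gamma>. if \<gamma> = \<alpha> then c else 0))"

definition lt_psp :: "(mon \<Rightarrow> mon \<Rightarrow> bool) \<Rightarrow> 'a::comm_ring_1 psp \<Rightarrow> 'a psp"
  where "lt_psp gt0 u =
    (if u = 0 then 0 else let p = greatest_in gt0 {p. psp_coeff u p \<noteq> 0} in mon_term p (psp_coeff u p))"

definition lm :: "(mmon \<Rightarrow> mmon \<Rightarrow> bool) \<Rightarrow> 'a::comm_ring_1 psv \<Rightarrow> mmon option"
  where "lm gt f = (if f = 0 then None else Some (greatest_in gt {p. psv_coeff f p \<noteq> 0}))"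

text \<open>\<open>0\<close> is smaller than every monomial.\<close>

fun lm_le :: "(mmon \<Rightarrow> mmon \<Rightarrow> bool) \<Rightarrow> mmon option \<Rightarrow> mmon option \<Rightarrow> bool"
  where
    "lm_le gt None b \<longleftrightarrow> True"
  | "lm_le gt (Some p) None \<longleftrightarrow> False"
  | "lm_le gt (Some p) (Some q) \<longleftrightarrow> p = q \<or> gt q p"

text \<open>\<open>0\<close> divides no monomial. (The case that a monomial divides \<open>0\<close> is never used.)\<close>

fun lm_dvd :: "mmon option \<Rightarrow> mmon option \<Rightarrow> bool"
  where
    "lm_dvd (Some p) (Some q) \<longleftrightarrow> mmon_dvd p q"
  | "lm_dvd None b \<longleftrightarrow> False"
  | "lm_dvd (Some p) None \<longleftrightarrow> True"

fun mmon_vec :: "mmon option \<Rightarrow> 'a::comm_ring_1 psv"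
  where
    "mmon_vec None = 0"
  | "mmon_vec (Some (p, i)) = (\<lambda>j. if j = i then mon_term p 1 else 0)"


section \<open>Localisation\<close>

definition S_gt :: "nat \<Rightarrow> nat \<Rightarrow> (mon \<Rightarrow> mon \<Rightarrow> bool) \<Rightarrow> 'a::comm_ring_1 psp set"
  where "S_gt m n gt0 = {u \<in> Rx m n. lt_psp gt0 u = 1}"

text \<open>\<open>R[x]\<close> is a domain and \<open>0 \<notin> S\<close>, so the localisation is a subring of the fraction field.\<close>

definition Rx_loc :: "nat \<Rightarrow> nat \<Rightarrow> (mon \<Rightarrow> mon \<Rightarrow> bool) \<Rightarrow> 'a::field psp fract set"
  where "Rx_loc m n gt0 = {Fract h u | h u. h \<in> Rx m n \<and> u \<in> S_gt m n gt0}"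

definition fract_vec :: "'a::field psv \<Rightarrow> nat \<Rightarrow> 'a psp fract"
  where "fract_vec f = (\<lambda>i. Fract (f i) 1)"

definition loc_span ::
    "nat \<Rightarrow> nat \<Rightarrow> (mon \<Rightarrow> mon \<Rightarrow> bool) \<Rightarrow> 'a::field psv set \<Rightarrow> (nat \<Rightarrow> 'a psp fract) set"
  where "loc_span m n gt0 B = (submodule_over (Rx_loc m n gt0)) hull (fract_vec ` B)"


section \<open>Standard bases and weak division\<close>

definition L_gt :: "nat \<Rightarrow> nat \<Rightarrow> (mmon \<Rightarrow> mmon \<Rightarrow> bool) \<Rightarrow> 'a::comm_ring_1 psv set \<Rightarrow> 'a psv set"
  where "L_gt m n gt G = (submodule_over (Ktx m n)) hull ((\<lambda>g. mmon_vec (lm gt g)) ` G)"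

definition standard_basis ::
    "nat \<Rightarrow> nat \<Rightarrow> (mmon \<Rightarrow> mmon \<Rightarrow> bool) \<Rightarrow> 'a::comm_ring_1 psv set \<Rightarrow> 'a psv set \<Rightarrow> bool"
  where "standard_basis m n gt G I \<longleftrightarrow> finite G \<and> G \<subseteq> I \<and> L_gt m n gt G = L_gt m n gt I"

definition weak_division ::
    "nat \<Rightarrow> nat \<Rightarrow> nat \<Rightarrow> (mmon \<Rightarrow> mmon \<Rightarrow> bool) \<Rightarrow> (mon \<Rightarrow> mon \<Rightarrow> bool) \<Rightarrow> 'a::comm_ring_1 psv list \<Rightarrow>
     'a psv \<Rightarrow> 'a psp \<Rightarrow> (nat \<Rightarrow> 'a psp) \<Rightarrow> 'a psv \<Rightarrow> bool"
  where "weak_division m n s gt gt0 gs f u q r \<longleftrightarrow>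
    u \<in> S_gt m n gt0 \<and> (\<forall>i<length gs. q i \<in> Rx m n) \<and> r \<in> Rxs m n s \<and>
    u \<odot> f = (\<Sum>i<length gs. q i \<odot> gs ! i) + r \<and>
    (\<forall>i<length gs. lm_le gt (lm gt (q i \<odot> gs ! i)) (lm gt f)) \<and>
    (r \<noteq> 0 \<longrightarrow> (\<forall>i<length gs. \<not> lm_dvd (lm gt (gs ! i)) (lm gt r)))"

definition weak_normal_form ::
    "nat \<Rightarrow> nat \<Rightarrow> nat \<Rightarrow> (mmon \<Rightarrow> mmon \<Rightarrow> bool) \<Rightarrow> (mon \<Rightarrow> mon \<Rightarrow> bool) \<Rightarrow> 'a::comm_ring_1 psv list \<Rightarrow>
     'a psv \<Rightarrow> 'a psv \<Rightarrow> bool"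
  where "weak_normal_form m n s gt gt0 gs f r \<longleftrightarrow> (\<exists>u q. weak_division m n s gt gt0 gs f u q r)"

definition has_weak_standard_rep ::
    "nat \<Rightarrow> nat \<Rightarrow> nat \<Rightarrow> (mmon \<Rightarrow> mmon \<Rightarrow> bool) \<Rightarrow> (mon \<Rightarrow> mon \<Rightarrow> bool) \<Rightarrow> 'a::comm_ring_1 psv list \<Rightarrow>
     'a psv \<Rightarrow> bool"
  where "has_weak_standard_rep m n s gt gt0 gs f \<longleftrightarrow> (\<exists>u q. weak_division m n s gt gt0 gs f u q 0)"

text \<open>The quotient \<open>lcm / lt\<close> is the term with exponent \<open>l - p\<close> and the inverse leading coefficient.\<close>

definition spoly :: "(mmon \<Rightarrow> mmon \<Rightarrow> bool) \<Rightarrow> 'a::field psv \<Rightarrow> 'a psv \<Rightarrow> 'a psv"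
  where "spoly gt f g =
    (case (lm gt f, lm gt g) of
       (Some p, Some q) \<Rightarrow>
         (case mmon_lcm p q of
            Some l \<Rightarrow> mon_term (fst l - fst p) (1 / psv_coeff f p) \<odot> f
                    - mon_term (fst l - fst q) (1 / psv_coeff g q) \<odot> g
          | None \<Rightarrow> 0)
     | _ \<Rightarrow> 0)"

end

theory Submission
  imports Defs "HOL.Topological_Spaces" "HOL.Vector_Spaces"
begin

text \<open>
  The implications that only compare leading monomials are short. If every leading monomial of
  \<open>I\<close> is divisible by one of \<open>G\<close>, a weak normal form of an element of \<open>I\<close>, being itself in \<open>I\<close>,
  must vanish; and in a weak standard representation \<open>u f = \<Sum> q\<^sub>i g\<^sub>i\<close> the monomial \<open>lm f = lm (u f)\<close>
  has to occur in some \<open>q\<^sub>i g\<^sub>i\<close>, so that it is divisible by \<open>lm g\<^sub>i\<close>. Two facts carry the rest.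

  The first is that weak normal forms exist (\<open>weak_division_exists\<close>). The ordering need not be
  a well-ordering, and as the coefficients are power series finitely many reductions need not suffice.
  For each \<open>D\<close> consider the remainders \<open>r = u f - \<Sum> q\<^sub>i g\<^sub>i\<close> with \<open>u \<in> S\<close>, \<open>lm (q\<^sub>i g\<^sub>i) \<le> lm f\<close> and all
  \<open>x\<close>-degrees of \<open>u\<close> and \<open>q\<^sub>i\<close> at most \<open>D\<close>. Every coefficient of \<open>r\<close> is an affine function of finitely
  many coefficients of \<open>u\<close> and the \<open>q\<^sub>i\<close>. A system of such linear equations over a field is solvable
  as soon as all its finite subsystems are (\<open>linear_system_compact\<close>), and this yields a remainder
  \<open>r\<^sub>D\<close> that is zero or has the smallest possible leading monomial (\<open>minimal_combination\<close>); it
  takes the place of a limit of infinitely many reductions. Suppose that every \<open>r\<^sub>D\<close> is non-zero and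
  every \<open>lm r\<^sub>D\<close> is still divisible by some \<open>lm g\<^sub>i\<close>. Subtracting a multiple of \<open>g\<^sub>i\<close> shows that \<open>lm r\<^sub>D\<close> becomes strictly smaller for some larger \<open>D\<close>,
  again and again. Apply Dickson's lemma to such a strictly decreasing sequence, adding to the
  exponents of \<open>lm r\<^sub>D\<close> the number \<open>D + C - deg\<^sub>x (lm r\<^sub>D)\<close>, which plays the role of the exponent of a
  homogenising variable. The result is a pair \<open>D < D'\<close> with \<open>lm r\<^bsub>D'\<^esub> = p \<cdot> lm r\<^sub>D\<close>, where \<open>p < 1\<close> and
  \<open>deg\<^sub>x p \<le> D' - D\<close>. As in Mora's tangent cone algorithm one may now reduce by an earlier
  remainder: \<open>r\<^bsub>D'\<^esub> - c p r\<^sub>D\<close> is a remainder of level \<open>D'\<close>, because \<open>p < 1\<close> keeps \<open>u\<^bsub>D'\<^esub> - c p u\<^sub>D\<close> in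
  \<open>S\<close>, and its leading monomial is smaller than the smallest possible one.

  The second fact is Buchberger's criterion (\<open>buchberger_criterion\<close>), proved with Schreyer's
  ordering on the coefficient vectors \<open>(h\<^sub>1, \<dots>, h\<^sub>k)\<close>: it compares the terms of \<open>h\<close> by the leading
  monomials they produce in \<open>\<Sum> h\<^sub>i g\<^sub>i\<close> and prefers the smaller index in case of a tie. A weak standard
  representation of an S-polynomial is a syzygy with leading monomial \<open>lcm / lm g\<^sub>i \<cdot> e\<^sub>i\<close>
  (\<open>spoly_syzygy\<close>). If \<open>u f = \<Sum> q\<^sub>i g\<^sub>i\<close> for some \<open>u \<in> S\<close>, which is what membership in the localised
  span means, divide \<open>q\<close> by these syzygies with the first fact. The remainder still represents \<open>f\<close>
  up to a unit of the localisation, and its leading term cannot be cancelled in the sum, since a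
  cancelling partner would make it divisible by the leading monomial of a syzygy. Hence no summand exceeds \<open>lm f\<close>.
\<close>

section \<open>Sums of functions and of power series\<close>

lemma sum_fun_apply: "(\<Sum>a\<in>A. f a) x = (\<Sum>a\<in>A. f a x)"
  by (induction A rule: infinite_finite_induct) simp_all

lemma mfps_nth_sum: "mfps_nth (\<Sum>a\<in>A. f a) \<alpha> = (\<Sum>a\<in>A. mfps_nth (f a) \<alpha>)"
  by (induction A rule: infinite_finite_induct) simp_all

section \<open>Linear systems over a field\<close>

text \<open>
  The left-hand sides are finitely supported functions, and a solution is the same as a linear
  functional taking prescribed values on them. Prescribe the values on a basis \<open>B\<close> of their span
  and extend; the remaining equations then hold because each of them involves, together with the
  equations of finitely many basis elements, only a finite subsystem.
\<close>

lemma linear_system_compact: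
  fixes a :: "'e \<Rightarrow> 'x \<Rightarrow> 'k::field" and b :: "'e \<Rightarrow> 'k"
  assumes fin: "\<And>e. e \<in> E \<Longrightarrow> finite {x. a e x \<noteq> 0}"
    and sol: "\<And>F. finite F \<Longrightarrow> F \<subseteq> E \<Longrightarrow> \<exists>v. \<forall>e\<in>F. (\<Sum>x | a e x \<noteq> 0. a e x * v x) = b e"
  shows "\<exists>v. \<forall>e\<in>E. (\<Sum>x | a e x \<noteq> 0. a e x * v x) = b e"
proof -
  let ?sc = "\<lambda>(c::'k) (f::'x \<Rightarrow> 'k) x. c * f x"
  interpret V: vector_space ?sc
    by unfold_locales (auto simp: fun_eq_iff algebra_simps)
  interpret K: vector_space "(*) :: 'k \<Rightarrow> 'k \<Rightarrow> 'k"
    by unfold_locales (auto simp: algebra_simps)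
  interpret VK: vector_space_pair ?sc "(*) :: 'k \<Rightarrow> 'k \<Rightarrow> 'k" ..
  obtain B where B: "B \<subseteq> a ` E" "V.independent B" "a ` E \<subseteq> V.span B"
    using V.maximal_independent_subset by blast
  let ?e = "inv_into E a"
  obtain L where lin: "Vector_Spaces.linear ?sc (*) L" and L: "\<forall>w\<in>B. L w = b (?e w)"
    using VK.linear_independent_extend[OF B(2), of "\<lambda>w. b (?e w)"] by blast
  interpret L: Vector_Spaces.linear ?sc "(*)" L by (fact lin)
  have e: "?e w \<in> E" "a (?e w) = w" if "w \<in> B" for w
    using that B(1) by (auto intro: inv_into_into f_inv_into_f)
  have Lb: "L (a c) = b c" if c: "c \<in> E" for c
  proof -
    obtain T r where T: "finite T" "T \<subseteq> B" and ac: "a c = (\<Sum>w\<in>T. ?sc (r w) w)"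
      using B(3) c unfolding V.span_explicit by auto
    \<comment> \<open>The equation of \<open>c\<close> together with those of the basis elements that express it.\<close>
    have "finite (insert c (?e ` T))" "insert c (?e ` T) \<subseteq> E"
      using T c e by auto
    from sol[OF this] obtain v where v: "\<forall>d\<in>insert c (?e ` T). (\<Sum>x | a d x \<noteq> 0. a d x * v x) = b d"
      by blast
    define U where "U = (\<Union>d\<in>insert c (?e ` T). {x. a d x \<noteq> 0})"
    have "finite U"
      unfolding U_def using T c e fin by auto
    have vU: "(\<Sum>x\<in>U. a d x * v x) = b d" if "d \<in> insert c (?e ` T)" for d
    proof -
      have "(\<Sum>x\<in>U. a d x * v x) = (\<Sum>x | a d x \<noteq> 0. a d x * v x)"
        by (rule sum.mono_neutral_right) (use \<open>finite U\<close> that in \<open>auto simp: U_def\<close>)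
      then show ?thesis using v that by auto
    qed
    have "L (a c) = (\<Sum>w\<in>T. r w * b (?e w))"
      using L T(2) by (auto simp: ac L.sum L.scale intro!: sum.cong)
    also have "\<dots> = (\<Sum>w\<in>T. \<Sum>x\<in>U. r w * w x * v x)"
    proof (rule sum.cong[OF refl])
      fix w assume "w \<in> T"
      then have "(\<Sum>x\<in>U. a (?e w) x * v x) = b (?e w)"
        by (intro vU) simp
      moreover have "a (?e w) = w"
        using e(2)[OF subsetD[OF T(2) \<open>w \<in> T\<close>]] .
      ultimately have "b (?e w) = (\<Sum>x\<in>U. w x * v x)"
        by simp
      then show "r w * b (?e w) = (\<Sum>x\<in>U. r w * w x * v x)"
        by (simp add: sum_distrib_left)
    qed
    also have "\<dots> = (\<Sum>x\<in>U. a c x * v x)"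
      unfolding ac by (subst sum.swap) (simp add: sum_distrib_right sum_fun_apply)
    also have "\<dots> = b c" using vU by simp
    finally show ?thesis .
  qed
  define v where "v x = L (\<lambda>y. if y = x then 1 else 0)" for x
  have "(\<Sum>x | a c x \<noteq> 0. a c x * v x) = b c" if c: "c \<in> E" for c
  proof -
    let ?X = "{x. a c x \<noteq> 0}"
    have "a c = (\<Sum>x\<in>?X. ?sc (a c x) (\<lambda>y. if y = x then 1 else 0))"
      using fin[OF c] by (auto simp: fun_eq_iff sum_fun_apply if_distrib sum.delta' cong: if_cong)
    then have "L (a c) = L (\<Sum>x\<in>?X. ?sc (a c x) (\<lambda>y. if y = x then 1 else 0))" by simp
    also have "\<dots> = (\<Sum>x\<in>?X. a c x * v x)"
      by (simp add: L.sum L.scale v_def)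
    finally show ?thesis using Lb[OF c] by simp
  qed
  then show ?thesis by blast
qed

section \<open>Dickson's lemma\<close>

text \<open>A decreasing sequence of natural numbers is eventually constant.\<close>

lemma nat_seq_mono_subseq:
  fixes f :: "nat \<Rightarrow> nat"
  shows "\<exists>\<phi> :: nat \<Rightarrow> nat. strict_mono \<phi> \<and> (\<forall>i j. i \<le> j \<longrightarrow> f (\<phi> i) \<le> f (\<phi> j))"
proof -
  obtain g :: "nat \<Rightarrow> nat" where g: "strict_mono g" "monoseq (\<lambda>k. f (g k))"
    using seq_monosub[of f] by blast
  show ?thesis
  proof (cases "\<forall>i. \<forall>j\<ge>i. f (g i) \<le> f (g j)")
    case True
    with g(1) show ?thesis by (intro exI[of _ g]) simp
  next
    case False
    then have dec: "f (g j) \<le> f (g i)" if "i \<le> j" for i j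
      using g(2) that unfolding monoseq_def by meson
    obtain N where N: "f (g N) \<le> f (g i)" for i
      using ex_has_least_nat[of "\<lambda>_. True" 0 "\<lambda>k. f (g k)"] by auto
    have "strict_mono (\<lambda>i. g (N + i))"
      using g(1) by (auto simp: strict_mono_def)
    moreover have "f (g (N + i)) \<le> f (g (N + j))" for i j
      using N[of "N + j"] dec[of N "N + i"] by auto
    ultimately show ?thesis by (intro exI[of _ "\<lambda>i. g (N + i)"]) auto
  qed
qed

lemma dickson_subseq:
  fixes f :: "nat \<Rightarrow> 'c \<Rightarrow> nat"
  assumes "finite N"
  shows "\<exists>\<phi> :: nat \<Rightarrow> nat. strict_mono \<phi> \<and> (\<forall>c\<in>N. \<forall>i j. i \<le> j \<longrightarrow> f (\<phi> i) c \<le> f (\<phi> j) c)"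
  using assms
proof induction
  case empty
  show ?case by (rule exI[of _ id]) (auto simp: strict_mono_def)
next
  case (insert c N)
  then obtain \<phi> :: "nat \<Rightarrow> nat" where \<phi>: "strict_mono \<phi>" "\<forall>c\<in>N. \<forall>i j. i \<le> j \<longrightarrow> f (\<phi> i) c \<le> f (\<phi> j) c"
    by blast
  obtain \<psi> :: "nat \<Rightarrow> nat" where \<psi>: "strict_mono \<psi>" "\<forall>i j. i \<le> j \<longrightarrow> f (\<phi> (\<psi> i)) c \<le> f (\<phi> (\<psi> j)) c"
    using nat_seq_mono_subseq[of "\<lambda>k. f (\<phi> k) c"] by blast
  have "strict_mono (\<lambda>i. \<phi> (\<psi> i))"
    using \<phi>(1) \<psi>(1) by (auto simp: strict_mono_def)
  moreover have "f (\<phi> (\<psi> i)) d \<le> f (\<phi> (\<psi> j)) d" if "i \<le> j" "d \<in> insert c N" for i j d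
    using that \<phi>(2) \<psi> by (auto simp: strict_mono_less_eq)
  ultimately show ?case by blast
qed

text \<open>A quantity \<open>x \<le> B\<close> can be forced to take the same value at \<open>i\<close> and \<open>j\<close> by using both \<open>x\<close> and
  \<open>B - x\<close> as coordinates.\<close>

lemma dickson:
  fixes f :: "nat \<Rightarrow> 'c \<Rightarrow> nat"
  assumes "finite N"
  obtains i j where "i < j" "\<forall>c\<in>N. f i c \<le> f j c"
proof -
  obtain \<phi> :: "nat \<Rightarrow> nat" where \<phi>: "strict_mono \<phi>" "\<forall>c\<in>N. \<forall>i j. i \<le> j \<longrightarrow> f (\<phi> i) c \<le> f (\<phi> j) c"
    using dickson_subseq[OF assms] by blast
  show thesis
    by (rule that[of "\<phi> 0" "\<phi> 1"]) (use \<phi> in \<open>auto simp: strict_mono_less\<close>)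
qed

section \<open>Coefficients of power series polynomials\<close>

lemma psp_eq_iff: "u = v \<longleftrightarrow> (\<forall>p. psp_coeff u p = psp_coeff v p)"
  by (auto simp: poly_mapping_eq_iff fun_eq_iff mfps_eq_iff)

lemma psp_coeff_eqs [simp]:
  "psp_coeff 0 p = 0"
  "psp_coeff (u + v) p = psp_coeff u p + psp_coeff v p"
  "psp_coeff (u - v) p = psp_coeff u p - psp_coeff v p"
  "psp_coeff (- u) p = - psp_coeff u p"
  by (cases p; simp add: lookup_add lookup_minus)+

lemma psp_coeff_one [simp]: "psp_coeff 1 p = (if p = 0 then 1 else 0)"
  by (cases p) (auto simp: lookup_one when_def zero_prod_def)

lemma psp_coeff_sum [simp]: "psp_coeff (sum u A) p = (\<Sum>a\<in>A. psp_coeff (u a) p)"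
  by (induction A rule: infinite_finite_induct) simp_all

lemma psp_coeff_mon_term [simp]: "psp_coeff (mon_term q c) p = (if p = q then c else 0)"
  by (cases p; cases q) (auto simp: lookup_single when_def)

lemma psv_eq_iff: "f = g \<longleftrightarrow> (\<forall>p. psv_coeff f p = psv_coeff g p)"
  by (auto simp: fun_eq_iff psp_eq_iff)

lemma psv_coeff_eqs [simp]:
  "psv_coeff 0 p = 0"
  "psv_coeff (f + g) p = psv_coeff f p + psv_coeff g p"
  "psv_coeff (f - g) p = psv_coeff f p - psv_coeff g p"
  "psv_coeff (- f) p = - psv_coeff f p"
  by (cases p; simp)+

lemma psv_coeff_sum [simp]: "psv_coeff (sum f A) p = (\<Sum>a\<in>A. psv_coeff (f a) p)"
  by (induction A rule: infinite_finite_induct) (simp_all only: sum.infinite sum.empty sum.insert psv_coeff_eqs not_False_eq_True)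

definition decomps :: "mon \<Rightarrow> (mon \<times> mon) set"
  where "decomps p = {(a, b). a + b = p}"

lemma finite_decomps [simp]: "finite (decomps p)"
proof (rule finite_subset)
  show "decomps p \<subseteq> (\<lambda>((a, b), (c, d)). ((a, c), (b, d))) `
      ({(\<alpha>, \<beta>). \<alpha> + \<beta> = fst p} \<times> {(\<alpha>, \<beta>). \<alpha> + \<beta> = snd p})"
    by (force simp: decomps_def image_iff)
qed auto

lemma psp_coeff_mult: "psp_coeff (u * v) p = (\<Sum>(a, b)\<in>decomps p. psp_coeff u a * psp_coeff v b)"
proof (cases p)
  case (Pair \<gamma> \<delta>)
  let ?D = "{(c, d). c + d = \<delta>}"
  have "lookup (u * v) \<delta> = (\<Sum>(c, d). lookup u c * lookup v d when \<delta> = c + d)"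
    by (simp add: times_poly_mapping.rep_eq prod_fun_unfold_prod)
  also have "\<dots> = (\<Sum>(c, d)\<in>?D. lookup u c * lookup v d)"
    by (subst Sum_any.expand_superset[of ?D]) (auto intro!: sum.cong)
  finally have "psp_coeff (u * v) p = (\<Sum>x\<in>?D. mfps_nth (lookup u (fst x) * lookup v (snd x)) \<gamma>)"
    unfolding Pair psp_coeff.simps
    by (simp add: case_prod_unfold mfps_nth_sum)
  also have "\<dots> = (\<Sum>(a, b)\<in>decomps p. psp_coeff u a * psp_coeff v b)"
    unfolding mfps_nth_mult
    apply (subst sum.Sigma)
      apply (simp_all)
    apply (rule sum.reindex_bij_witness[where
          i = "\<lambda>((a, b), (c, d)). ((b, d), (a, c))" and j = "\<lambda>((b, d), (a, c)). ((a, b), (c, d))"])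
    by (auto simp: decomps_def Pair)
  finally show ?thesis .
qed

lemma psv_coeff_smult:
  "psv_coeff (u \<odot> f) (p, i) = (\<Sum>(a, b)\<in>decomps p. psp_coeff u a * psv_coeff f (b, i))"
  by (simp add: smult_vec_def psp_coeff_mult)

section \<open>Carriers in terms of coefficients\<close>

text \<open>From here on polynomials and vectors are handled through their coefficients at whole
  monomials only, so monomials are not split into their exponents.\<close>

declare psp_coeff.simps [simp del] psv_coeff.simps [simp del] split_paired_All [simp del] split_paired_Ex [simp del]

lemma zero_in_Mon [simp]: "0 \<in> Mon m n"
  by (auto simp: Mon_def Exp_def zero_prod_def)

lemma t_in_Mon_iff [simp]: "(\<gamma>, 0) \<in> Mon m n \<longleftrightarrow> \<gamma> \<in> Exp m"
  by (auto simp: Mon_def Exp_def)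

lemma add_in_Mon_iff [simp]: "p + q \<in> Mon m n \<longleftrightarrow> p \<in> Mon m n \<and> q \<in> Mon m n"
  by (cases p; cases q) (auto simp: Mon_def Exp_def keys_add_expo)

lemma in_MMon_iff [simp]: "(p, i) \<in> MMon m n s \<longleftrightarrow> p \<in> Mon m n \<and> i < s"
  by (auto simp: MMon_def)

lemma mon_act_in_MMon_iff [simp]: "mon_act r p \<in> MMon m n s \<longleftrightarrow> r \<in> Mon m n \<and> p \<in> MMon m n s"
  by (cases p) auto

lemma Rx_iff: "u \<in> Rx m n \<longleftrightarrow> (\<forall>p. psp_coeff u p \<noteq> 0 \<longrightarrow> p \<in> Mon m n)"
proof
  assume u: "u \<in> Rx m n"
  show "\<forall>p. psp_coeff u p \<noteq> 0 \<longrightarrow> p \<in> Mon m n"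
  proof safe
    fix \<alpha> \<beta> assume nz: "psp_coeff u (\<alpha>, \<beta>) \<noteq> 0"
    then have "\<beta> \<in> keys u" by (auto simp: in_keys_iff psp_coeff.simps)
    then show "(\<alpha>, \<beta>) \<in> Mon m n" using u nz by (auto simp: Rx_def PS_def Mon_def psp_coeff.simps)
  qed
next
  assume *: "\<forall>p. psp_coeff u p \<noteq> 0 \<longrightarrow> p \<in> Mon m n"
  have "\<beta> \<in> Exp n" if "\<beta> \<in> keys u" for \<beta>
  proof -
    from that have "lookup u \<beta> \<noteq> 0" by (simp add: in_keys_iff)
    then obtain \<alpha> where "mfps_nth (lookup u \<beta>) \<alpha> \<noteq> 0" by (auto simp: mfps_eq_iff)
    then show ?thesis using *[rule_format, of "(\<alpha>, \<beta>)"] by (simp add: Mon_def psp_coeff.simps)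
  qed
  moreover have "lookup u \<beta> \<in> PS m" for \<beta>
    using *[rule_format, of "(_, \<beta>)"] by (auto simp: PS_def Mon_def psp_coeff.simps)
  ultimately show "u \<in> Rx m n" by (auto simp: Rx_def)
qed

lemma Rxs_iff: "f \<in> Rxs m n s \<longleftrightarrow> (\<forall>p. psv_coeff f p \<noteq> 0 \<longrightarrow> p \<in> MMon m n s)"
proof
  assume f: "f \<in> Rxs m n s"
  show "\<forall>p. psv_coeff f p \<noteq> 0 \<longrightarrow> p \<in> MMon m n s"
  proof safe
    fix p i assume nz: "psv_coeff f (p, i) \<noteq> 0"
    then have "f i \<noteq> 0" by (auto simp: psv_coeff.simps)
    then have "i < s" using f by (auto simp: Rxs_def not_le[symmetric])
    then show "(p, i) \<in> MMon m n s" using f nz by (auto simp: Rxs_def Rx_iff psv_coeff.simps)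
  qed
next
  assume *: "\<forall>p. psv_coeff f p \<noteq> 0 \<longrightarrow> p \<in> MMon m n s"
  have "f i \<in> Rx m n" if "i < s" for i
    unfolding Rx_iff using * by (metis in_MMon_iff psv_coeff.simps)
  moreover have "f i = 0" if "i \<ge> s" for i
    unfolding psp_eq_iff using * that by (metis in_MMon_iff psv_coeff.simps not_le psp_coeff_eqs(1))
  ultimately show "f \<in> Rxs m n s" by (auto simp: Rxs_def)
qed

lemma Rx_zero [simp]: "0 \<in> Rx m n"
  and Rx_one [simp]: "1 \<in> Rx m n"
  by (auto simp: Rx_iff)

lemma Rx_add: "u \<in> Rx m n \<Longrightarrow> v \<in> Rx m n \<Longrightarrow> u + v \<in> Rx m n"
  and Rx_diff: "u \<in> Rx m n \<Longrightarrow> v \<in> Rx m n \<Longrightarrow> u - v \<in> Rx m n"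
  and Rx_uminus: "u \<in> Rx m n \<Longrightarrow> - u \<in> Rx m n"
  unfolding Rx_iff by (simp_all, metis add_0 add_0_right, metis diff_0_right diff_0 neg_equal_0_iff_equal)

lemma Rx_mult:
  assumes "u \<in> Rx m n" "v \<in> Rx m n"
  shows "u * v \<in> Rx m n"
  unfolding Rx_iff
proof (intro allI impI)
  fix p assume "psp_coeff (u * v) p \<noteq> 0"
  then obtain a b where "(a, b) \<in> decomps p" "psp_coeff u a * psp_coeff v b \<noteq> 0"
    unfolding psp_coeff_mult by (auto elim: sum.not_neutral_contains_not_neutral)
  then have "a + b = p" "psp_coeff u a \<noteq> 0" "psp_coeff v b \<noteq> 0"
    by (auto simp: decomps_def)
  then show "p \<in> Mon m n" using assms by (auto simp: Rx_iff)
qed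

lemma Rx_mon_term: "p \<in> Mon m n \<Longrightarrow> mon_term p c \<in> Rx m n"
  by (auto simp: Rx_iff split: if_splits)

lemma Rxs_zero [simp]: "0 \<in> Rxs m n s"
  by (auto simp: Rxs_def)

lemma Rxs_add: "f \<in> Rxs m n s \<Longrightarrow> g \<in> Rxs m n s \<Longrightarrow> f + g \<in> Rxs m n s"
  and Rxs_diff: "f \<in> Rxs m n s \<Longrightarrow> g \<in> Rxs m n s \<Longrightarrow> f - g \<in> Rxs m n s"
  by (auto simp: Rxs_def intro: Rx_add Rx_diff)

lemma Rxs_smult: "u \<in> Rx m n \<Longrightarrow> f \<in> Rxs m n s \<Longrightarrow> u \<odot> f \<in> Rxs m n s"
  by (auto simp: Rxs_def smult_vec_def intro: Rx_mult)

lemma Rxs_sum: "(\<And>a. a \<in> A \<Longrightarrow> f a \<in> Rxs m n s) \<Longrightarrow> sum f A \<in> Rxs m n s"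
  by (induction A rule: infinite_finite_induct) (simp_all add: Rxs_add)

lemma smult_coeff_nonzeroE:
  assumes "psv_coeff (u \<odot> f) (p, i) \<noteq> 0"
  obtains a b where "a + b = p" "psp_coeff u a \<noteq> 0" "psv_coeff f (b, i) \<noteq> 0"
proof -
  obtain a b where "(a, b) \<in> decomps p" "psp_coeff u a * psv_coeff f (b, i) \<noteq> 0"
    using assms unfolding psv_coeff_smult by (auto elim: sum.not_neutral_contains_not_neutral)
  then show ?thesis by (intro that[of a b]) (auto simp: decomps_def)
qed

definition xdeg :: "nat \<Rightarrow> mon \<Rightarrow> nat"
  where "xdeg n p = (\<Sum>k<n. lookup (snd p) k)"

lemma xdeg_add [simp]: "xdeg n (p + q) = xdeg n p + xdeg n q"
  by (simp add: xdeg_def lookup_add sum.distrib)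

lemma xdeg_zero [simp]: "xdeg n 0 = 0"
  by (simp add: xdeg_def)

lemma lookup_le_xdeg: "k < n \<Longrightarrow> lookup (snd p) k \<le> xdeg n p"
  unfolding xdeg_def by (rule member_le_sum) auto

lemma psp_xdeg_bound: "\<exists>D. \<forall>p. psp_coeff u p \<noteq> 0 \<longrightarrow> xdeg n p \<le> D"
proof (intro exI allI impI)
  fix p assume "psp_coeff u p \<noteq> 0"
  then have "snd p \<in> keys u" by (cases p) (auto simp: in_keys_iff psp_coeff.simps)
  then show "xdeg n p \<le> Max ((\<lambda>\<beta>. xdeg n (0, \<beta>)) ` keys u)"
    by (intro Max_ge) (auto simp: xdeg_def image_iff)
qed

lemma psv_xdeg_bound:
  assumes "f \<in> Rxs m n s"
  shows "\<exists>D. \<forall>p. psv_coeff f p \<noteq> 0 \<longrightarrow> xdeg n (fst p) \<le> D"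
proof -
  obtain D where D: "\<And>i p. psp_coeff (f i) p \<noteq> 0 \<longrightarrow> xdeg n p \<le> D i"
    using psp_xdeg_bound[of "f _" n] by metis
  have "xdeg n (fst p) \<le> Max (D ` {..<s})" if "psv_coeff f p \<noteq> 0" for p
  proof -
    have "snd p < s" using that assms by (cases p) (auto simp: Rxs_iff)
    then have "D (snd p) \<le> Max (D ` {..<s})" by (intro Max_ge) auto
    moreover have "xdeg n (fst p) \<le> D (snd p)" using that D by (cases p) (auto simp: psv_coeff.simps)
    ultimately show ?thesis by simp
  qed
  then show ?thesis by blast
qed

text \<open>The bound leaves finitely many exponents of \<open>x\<close>, hence a polynomial, whose coefficients may be
  arbitrary power series.\<close>

lemma psp_of_coeffs:
  fixes c :: "mon \<Rightarrow> 'a::comm_ring_1"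
  assumes "\<And>p. c p \<noteq> 0 \<Longrightarrow> p \<in> Mon m n \<and> xdeg n p \<le> D"
  obtains u where "\<And>p. psp_coeff u p = c p"
proof -
  let ?f = "\<lambda>\<beta>. Abs_mfps (\<lambda>\<alpha>. c (\<alpha>, \<beta>))"
  have "finite {\<beta>. ?f \<beta> \<noteq> 0}"
  proof (rule finite_subset)
    show "{\<beta>. ?f \<beta> \<noteq> 0} \<subseteq> {\<beta>. keys \<beta> \<subseteq> {..<n} \<and> (\<forall>k\<in>{..<n}. lookup \<beta> k \<le> D)}"
    proof safe
      fix \<beta> assume "?f \<beta> \<noteq> 0"
      then obtain \<alpha> where "c (\<alpha>, \<beta>) \<noteq> 0" by (auto simp: mfps_eq_iff)
      note * = assms[OF this]
      then show "k < n" if "k \<in> keys \<beta>" for k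
        using that by (auto simp: Mon_def Exp_def)
      show "lookup \<beta> k \<le> D" if "k < n" for k
        using lookup_le_xdeg[OF that, of "(\<alpha>, \<beta>)"] * by simp
    qed
  qed (rule finite_bounded_expos, simp)
  then have "lookup (Abs_poly_mapping ?f) = ?f"
    by (rule lookup_Abs_poly_mapping)
  then show ?thesis by (intro that[of "Abs_poly_mapping ?f"]) (auto simp: psp_coeff.simps split_paired_all)
qed

section \<open>Leading monomials\<close>

lemma expo_decomp: "(\<And>k. lookup \<alpha> k \<le> lookup (\<beta> :: expo) k) \<Longrightarrow> \<beta> = (\<beta> - \<alpha>) + \<alpha>"
  by (rule poly_mapping_eqI) (simp add: lookup_add lookup_minus)

text \<open>Dickson's lemma for module monomials. The coordinates \<open>k\<close> and \<open>s - k\<close> of the component \<open>k\<close>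
  together force both monomials into the same component; \<open>N\<close> holds further quantities that have
  to increase along with the monomials.\<close>

lemma mmon_dickson:
  fixes x :: "nat \<Rightarrow> mmon" and N :: "(nat \<Rightarrow> nat) set"
  assumes "finite N" and x: "\<And>k. x k \<in> MMon m n s"
  obtains i j a where "i < j" "a \<in> Mon m n" "x j = mon_act a (x i)" "\<And>c. c \<in> N \<Longrightarrow> c i \<le> c j"
proof -
  let ?N = "(\<lambda>l k. lookup (fst (fst (x k))) l) ` {..<m} \<union> (\<lambda>l k. lookup (snd (fst (x k))) l) ` {..<n}
    \<union> {\<lambda>k. snd (x k), \<lambda>k. s - snd (x k)} \<union> N"
  obtain i j where "i < j" and "\<forall>c\<in>?N. c i \<le> c j"
    by (rule dickson[of ?N "\<lambda>k c. c k"]) (use assms(1) in auto)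
  then have ij: "c i \<le> c j" if "c \<in> ?N" for c
    using bspec[OF _ that] by simp
  obtain \<alpha> \<beta> k where xi: "x i = ((\<alpha>, \<beta>), k)" by (metis surj_pair)
  obtain \<alpha>' \<beta>' k' where xj: "x j = ((\<alpha>', \<beta>'), k')" by (metis surj_pair)
  have mm: "((\<alpha>, \<beta>), k) \<in> MMon m n s" "((\<alpha>', \<beta>'), k') \<in> MMon m n s"
    using x[of i] x[of j] xi xj by simp_all
  have "k \<le> k'" "s - k \<le> s - k'"
    using ij[of "\<lambda>k. snd (x k)"] ij[of "\<lambda>k. s - snd (x k)"] xi xj by auto
  with mm have k: "k' = k" by auto
  have "lookup \<alpha> l \<le> lookup \<alpha>' l" for l
  proof (cases "l < m")
    case True
    then show ?thesis using ij[of "\<lambda>k. lookup (fst (fst (x k))) l"] xi xj by auto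
  next
    case False
    then have "l \<notin> keys \<alpha>" using mm by (auto simp: Mon_def Exp_def)
    then show ?thesis by (simp add: in_keys_iff)
  qed
  then have \<alpha>: "\<alpha>' = (\<alpha>' - \<alpha>) + \<alpha>" by (rule expo_decomp)
  have "lookup \<beta> l \<le> lookup \<beta>' l" for l
  proof (cases "l < n")
    case True
    then show ?thesis using ij[of "\<lambda>k. lookup (snd (fst (x k))) l"] xi xj by auto
  next
    case False
    then have "l \<notin> keys \<beta>" using mm by (auto simp: Mon_def Exp_def)
    then show ?thesis by (simp add: in_keys_iff)
  qed
  then have \<beta>: "\<beta>' = (\<beta>' - \<beta>) + \<beta>" by (rule expo_decomp)
  have eq: "x j = mon_act (\<alpha>' - \<alpha>, \<beta>' - \<beta>) (x i)"
    using \<alpha> \<beta> k xi xj by simp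
  then have "(\<alpha>' - \<alpha>, \<beta>' - \<beta>) \<in> Mon m n"
    using x[of j] by simp
  then show thesis using that \<open>i < j\<close> eq ij by blast
qed

text \<open>
  This is why leading monomials exist although the power series have infinitely many terms. A
  strictly increasing sequence of monomials of bounded \<open>x\<close>-degree would, by Dickson's lemma,
  contain a monomial dividing a later one. With \<open>D - deg\<^sub>x\<close> as additional coordinate the quotient is
  free of \<open>x\<close>, so locality makes the later monomial the smaller one.
\<close>

lemma bounded_set_has_greatest:
  assumes A: "A \<subseteq> MMon m n s" "A \<noteq> {}" and D: "\<And>p. p \<in> A \<Longrightarrow> xdeg n (fst p) \<le> D"
    and R: "strict_total_on A R"
    and loc: "\<And>p \<gamma>. p \<in> A \<Longrightarrow> mon_act (\<gamma>, 0) p \<in> A \<Longrightarrow> \<gamma> \<noteq> 0 \<Longrightarrow> R p (mon_act (\<gamma>, 0) p)"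
  shows "\<exists>p\<in>A. \<forall>q\<in>A. q \<noteq> p \<longrightarrow> R p q"
proof (rule ccontr)
  have trans: "R p r" if "R p q" "R q r" "p \<in> A" "q \<in> A" "r \<in> A" for p q r
    using R that unfolding strict_total_on_def transp_on_def by blast
  have irr: "\<not> R p p" if "p \<in> A" for p
    using R that unfolding strict_total_on_def irreflp_on_def by blast
  assume "\<not> ?thesis"
  then have "\<forall>p\<in>A. \<exists>q\<in>A. R q p"
    using R unfolding strict_total_on_def totalp_on_def by metis
  moreover obtain a where "a \<in> A" using A by blast
  ultimately obtain x where x: "\<And>k. x k \<in> A" "\<And>k. R (x (Suc k)) (x k)"
    using dependent_nat_choice[of "\<lambda>k p. p \<in> A" "\<lambda>k p q. R q p"] by metis
  have less: "R (x j) (x i)" if "i < j" for i j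
    using that
  proof (induction rule: less_Suc_induct)
    case (1 i) then show ?case by (rule x)
  next
    case (2 i j k) then show ?case using trans x by blast
  qed
  have xM: "x k \<in> MMon m n s" for k using x A by blast
  obtain i j a where "i < j" "a \<in> Mon m n" and xj: "x j = mon_act a (x i)"
    and "\<And>c. c \<in> {\<lambda>k. D - xdeg n (fst (x k))} \<Longrightarrow> c i \<le> c j"
    by (rule mmon_dickson[of "{\<lambda>k. D - xdeg n (fst (x k))}" x m n s])
      (simp_all add: xM)
  then have "D - xdeg n (fst (x i)) \<le> D - xdeg n (fst (x j))" by simp
  moreover have "xdeg n (fst (x j)) = xdeg n a + xdeg n (fst (x i))"
    using xj by (cases "x i") simp
  ultimately have "xdeg n a = 0"
    using D[OF x(1)[of i]] D[OF x(1)[of j]] by linarith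
  have "lookup (snd a) l = 0" for l
  proof (cases "l < n")
    case True
    then show ?thesis using lookup_le_xdeg[OF True, of a] \<open>xdeg n a = 0\<close> by simp
  next
    case False
    then have "l \<notin> keys (snd a)" using \<open>a \<in> Mon m n\<close> by (cases a) (auto simp: Mon_def Exp_def)
    then show ?thesis by (simp add: in_keys_iff)
  qed
  then have "snd a = 0" by (intro poly_mapping_eqI) simp
  then have eq: "x j = mon_act (fst a, 0) (x i)"
    using xj by (metis prod.collapse)
  show False
  proof (cases "fst a = 0")
    case True
    then have "x j = x i" using eq by (cases "x i") (simp flip: zero_prod_def)
    then show ?thesis using less[OF \<open>i < j\<close>] irr x by metis
  next
    case False
    then have "R (x i) (x j)" using loc[OF x(1)[of i], of "fst a"] eq x(1)[of j] by simp
    then show ?thesis using less[OF \<open>i < j\<close>] trans irr x by blast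
  qed
qed

lemma greatest_in_eqI:
  assumes "p \<in> A" "\<And>q. q \<in> A \<Longrightarrow> q \<noteq> p \<Longrightarrow> R p q" "strict_total_on A R"
  shows "greatest_in R A = p"
  unfolding greatest_in_def
proof (rule the_equality)
  fix p' assume p': "p' \<in> A \<and> (\<forall>q\<in>A. q \<noteq> p' \<longrightarrow> R p' q)"
  show "p' = p"
    using assms p' unfolding strict_total_on_def irreflp_on_def transp_on_def by metis
qed (use assms in auto)

lemma strict_total_on_subset: "strict_total_on A R \<Longrightarrow> B \<subseteq> A \<Longrightarrow> strict_total_on B R"
  unfolding strict_total_on_def
  by (auto intro: irreflp_on_subset transp_on_subset totalp_on_subset)

text \<open>A locale, because the division theorem is needed for two orderings: the given one on \<open>R[x]\<^sup>s\<close> and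
  Schreyer's ordering on \<open>R[x]\<^sup>k\<close>. Both induce the same \<open>gt0\<close>.\<close>

locale t_local_ordering =
  fixes m n s :: nat
    and gt :: "mmon \<Rightarrow> mmon \<Rightarrow> bool"
    and gt0 :: "mon \<Rightarrow> mon \<Rightarrow> bool"
  assumes gt_ordering: "module_monomial_ordering m n s gt"
    and gt0_induced: "induced_ordering m n s gt gt0"
    and gt0_local: "t_local m gt0"
begin

abbreviation "M0 \<equiv> Mon m n"
abbreviation "MM \<equiv> MMon m n s"

lemma gt0_total_on: "strict_total_on M0 gt0"
  using gt0_induced by (auto simp: induced_ordering_def monomial_ordering_def)

lemma gt_total_on: "strict_total_on MM gt"
  using gt_ordering by (auto simp: module_monomial_ordering_def)

lemma gt0_irrefl: "p \<in> M0 \<Longrightarrow> \<not> gt0 p p"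
  using gt0_total_on unfolding strict_total_on_def irreflp_on_def by blast

lemma gt_irrefl: "p \<in> MM \<Longrightarrow> \<not> gt p p"
  using gt_total_on unfolding strict_total_on_def irreflp_on_def by blast

lemma gt0_trans: "gt0 p q \<Longrightarrow> gt0 q r \<Longrightarrow> p \<in> M0 \<Longrightarrow> q \<in> M0 \<Longrightarrow> r \<in> M0 \<Longrightarrow> gt0 p r"
  using gt0_total_on unfolding strict_total_on_def transp_on_def by blast

lemma gt_trans: "gt p q \<Longrightarrow> gt q r \<Longrightarrow> p \<in> MM \<Longrightarrow> q \<in> MM \<Longrightarrow> r \<in> MM \<Longrightarrow> gt p r"
  using gt_total_on unfolding strict_total_on_def transp_on_def by blast

lemma gt_total: "p \<in> MM \<Longrightarrow> q \<in> MM \<Longrightarrow> p \<noteq> q \<Longrightarrow> gt p q \<or> gt q p"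
  using gt_total_on unfolding strict_total_on_def totalp_on_def by blast

lemma gt0_total: "p \<in> M0 \<Longrightarrow> q \<in> M0 \<Longrightarrow> p \<noteq> q \<Longrightarrow> gt0 p q \<or> gt0 q p"
  using gt0_total_on unfolding strict_total_on_def totalp_on_def by blast

lemma gt0_add: "gt0 p q \<Longrightarrow> p \<in> M0 \<Longrightarrow> q \<in> M0 \<Longrightarrow> r \<in> M0 \<Longrightarrow> gt0 (r + p) (r + q)"
  using gt0_induced by (auto simp: induced_ordering_def monomial_ordering_def)

lemma gt_act: "gt p q \<Longrightarrow> p \<in> MM \<Longrightarrow> q \<in> MM \<Longrightarrow> r \<in> M0 \<Longrightarrow> gt (mon_act r p) (mon_act r q)"
  using gt_ordering by (auto simp: module_monomial_ordering_def)

lemma gt_gt0: "i < s \<Longrightarrow> p \<in> M0 \<Longrightarrow> q \<in> M0 \<Longrightarrow> gt (p, i) (q, i) \<longleftrightarrow> gt0 p q"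
  using gt0_induced by (auto simp: induced_ordering_def)

lemma gt_act0: "gt0 p q \<Longrightarrow> p \<in> M0 \<Longrightarrow> q \<in> M0 \<Longrightarrow> w \<in> MM \<Longrightarrow> gt (mon_act p w) (mon_act q w)"
  using gt0_add[of p q "fst w"] gt_gt0 by (cases w) (auto simp: add.commute)

lemma gt0_one_t: "\<alpha> \<in> Exp m \<Longrightarrow> \<alpha> \<noteq> 0 \<Longrightarrow> gt0 0 (\<alpha>, 0)"
proof (induction "\<Sum>k<m. lookup \<alpha> k" arbitrary: \<alpha> rule: less_induct)
  case (less \<alpha>)
  from less.prems obtain i where i: "lookup \<alpha> i \<noteq> 0" "i < m"
    by (auto simp: Exp_def poly_mapping_eq_iff fun_eq_iff subset_iff in_keys_iff)
  let ?e = "Poly_Mapping.single i (1 :: nat)"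
  have e: "?e \<in> Exp m" "gt0 0 (?e, 0)"
    using i gt0_local by (auto simp: Exp_def t_local_def zero_prod_def)
  have \<alpha>: "\<alpha> = (\<alpha> - ?e) + ?e"
    by (rule expo_decomp) (use i in \<open>auto simp: lookup_single when_def\<close>)
  then have ex: "\<alpha> - ?e \<in> Exp m"
    using less.prems(1) keys_add_expo[of "\<alpha> - ?e" ?e] by (auto simp: Exp_def)
  show ?case
  proof (cases "\<alpha> - ?e = 0")
    case True
    then show ?thesis using \<alpha> e by simp
  next
    case False
    have "(\<Sum>k<m. lookup \<alpha> k) = (\<Sum>k<m. lookup (\<alpha> - ?e) k) + (\<Sum>k<m. lookup ?e k)"
      unfolding sum.distrib[symmetric] by (rule sum.cong[OF refl]) (metis \<alpha> lookup_add)
    moreover have "(\<Sum>k<m. lookup ?e k) = 1"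
      using i by (simp add: lookup_single when_def)
    ultimately have "gt0 0 (\<alpha> - ?e, 0)"
      using less.hyps[OF _ ex False] by simp
    then have "gt0 ((?e, 0) + 0) ((?e, 0) + (\<alpha> - ?e, 0))"
      using ex e by (intro gt0_add) auto
    then have "gt0 (?e, 0) (\<alpha>, 0)"
      using \<alpha> by (simp add: add.commute)
    from gt0_trans[OF e(2) this] show ?thesis
      using e less.prems by simp
  qed
qed

lemma has_greatest_gt:
  assumes "A \<subseteq> MM" "A \<noteq> {}" and D: "\<And>p. p \<in> A \<Longrightarrow> xdeg n (fst p) \<le> D"
  shows "\<exists>p\<in>A. \<forall>q\<in>A. q \<noteq> p \<longrightarrow> gt p q"
proof (rule bounded_set_has_greatest[OF assms])
  show "strict_total_on A gt" using gt_total_on assms(1) by (rule strict_total_on_subset)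
next
  fix p \<gamma> assume *: "p \<in> A" "mon_act (\<gamma>, 0) p \<in> A" "\<gamma> \<noteq> 0"
  then have "mon_act (\<gamma>, 0) p \<in> MM" "p \<in> MM" using assms by auto
  then have "gt (mon_act 0 p) (mon_act (\<gamma>, 0) p)"
    using * by (intro gt_act0 gt0_one_t) simp_all
  then show "gt p (mon_act (\<gamma>, 0) p)" by (cases p) simp
qed auto

text \<open>The monomials of the ring are treated as those of the free module of rank one, and not as those
  of a component of \<open>R[x]\<^sup>s\<close>, since \<open>s\<close> may be zero.\<close>

lemma has_greatest_gt0:
  assumes "A \<subseteq> M0" "A \<noteq> {}" and D: "\<And>p. p \<in> A \<Longrightarrow> xdeg n p \<le> D"
  shows "\<exists>p\<in>A. \<forall>q\<in>A. q \<noteq> p \<longrightarrow> gt0 p q"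
proof -
  have "\<exists>p\<in>A \<times> {0::nat}. \<forall>q\<in>A \<times> {0}. q \<noteq> p \<longrightarrow> gt0 (fst p) (fst q)"
  proof (rule bounded_set_has_greatest[of "A \<times> {0}" m n 1 D "\<lambda>p q. gt0 (fst p) (fst q)"])
    show "strict_total_on (A \<times> {0::nat}) (\<lambda>p q. gt0 (fst p) (fst q))"
      using strict_total_on_subset[OF gt0_total_on assms(1)]
      unfolding strict_total_on_def irreflp_on_def transp_on_def totalp_on_def by fastforce
  next
    fix p :: "mon \<times> nat" and \<gamma>
    assume *: "p \<in> A \<times> {0}" "mon_act (\<gamma>, 0) p \<in> A \<times> {0}" "\<gamma> \<noteq> 0"
    obtain q where q: "p = (q, 0)" "q \<in> A" using * by auto
    then have "(\<gamma>, 0) + q \<in> M0" using assms * by auto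
    then have "gt0 (q + 0) (q + (\<gamma>, 0))"
      using *(3) by (intro gt0_add gt0_one_t) simp_all
    then show "gt0 (fst p) (fst (mon_act (\<gamma>, 0) p))"
      using q by (simp add: add.commute)
  qed (use assms in \<open>auto simp: MMon_def\<close>)
  then show ?thesis by auto
qed

definition ge :: "mmon \<Rightarrow> mmon \<Rightarrow> bool"
  where "ge p q \<longleftrightarrow> p = q \<or> gt p q"

lemma ge_trans: "ge p q \<Longrightarrow> ge q r \<Longrightarrow> p \<in> MM \<Longrightarrow> q \<in> MM \<Longrightarrow> r \<in> MM \<Longrightarrow> ge p r"
  unfolding ge_def using gt_trans by metis

lemma ge_gt_trans: "ge p q \<Longrightarrow> gt q r \<Longrightarrow> p \<in> MM \<Longrightarrow> q \<in> MM \<Longrightarrow> r \<in> MM \<Longrightarrow> gt p r"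
  unfolding ge_def using gt_trans by metis

lemma gt_ge_trans: "gt p q \<Longrightarrow> ge q r \<Longrightarrow> p \<in> MM \<Longrightarrow> q \<in> MM \<Longrightarrow> r \<in> MM \<Longrightarrow> gt p r"
  unfolding ge_def using gt_trans by metis

lemma ge_act: "ge p q \<Longrightarrow> p \<in> MM \<Longrightarrow> q \<in> MM \<Longrightarrow> r \<in> M0 \<Longrightarrow> ge (mon_act r p) (mon_act r q)"
  unfolding ge_def using gt_act by metis

lemma lm_eqI:
  assumes "f \<in> Rxs m n s" "psv_coeff f p \<noteq> 0" "\<And>q. psv_coeff f q \<noteq> 0 \<Longrightarrow> ge p q"
  shows "lm gt f = Some p"
proof -
  have "{p. psv_coeff f p \<noteq> 0} \<subseteq> MM" using assms(1) by (auto simp: Rxs_iff)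
  then have "greatest_in gt {p. psv_coeff f p \<noteq> 0} = p"
    using assms(2,3) strict_total_on_subset[OF gt_total_on] by (intro greatest_in_eqI) (auto simp: ge_def)
  moreover have "f \<noteq> 0" using assms(2) by auto
  ultimately show ?thesis by (simp add: lm_def)
qed

lemma lm_exists:
  assumes "f \<in> Rxs m n s" "f \<noteq> 0"
  obtains p where "lm gt f = Some p" "p \<in> MM" "psv_coeff f p \<noteq> 0" "\<And>q. psv_coeff f q \<noteq> 0 \<Longrightarrow> ge p q"
proof -
  let ?A = "{p. psv_coeff f p \<noteq> 0}"
  have A: "?A \<subseteq> MM" using assms(1) by (auto simp: Rxs_iff)
  have "?A \<noteq> {}" using assms(2) psv_eq_iff[of f 0] by auto
  moreover obtain D where "\<forall>p. psv_coeff f p \<noteq> 0 \<longrightarrow> xdeg n (fst p) \<le> D"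
    using psv_xdeg_bound[OF assms(1)] by blast
  ultimately obtain p where p: "p \<in> ?A" "\<forall>q\<in>?A. q \<noteq> p \<longrightarrow> gt p q"
    using has_greatest_gt[OF A, of D] by blast
  then have *: "psv_coeff f p \<noteq> 0" "\<And>q. psv_coeff f q \<noteq> 0 \<Longrightarrow> ge p q"
    by (auto simp: ge_def)
  show thesis by (rule that[OF lm_eqI[OF assms(1) *] _ *]) (use * A in auto)
qed

lemma lm_SomeD:
  assumes "f \<in> Rxs m n s" "lm gt f = Some p"
  shows "f \<noteq> 0" "p \<in> MM" "psv_coeff f p \<noteq> 0" "\<And>q. psv_coeff f q \<noteq> 0 \<Longrightarrow> ge p q"
proof -
  show "f \<noteq> 0" using assms(2) by (auto simp: lm_def)
  then obtain p' where p': "lm gt f = Some p'" "p' \<in> MM" "psv_coeff f p' \<noteq> 0" "\<And>q. psv_coeff f q \<noteq> 0 \<Longrightarrow> ge p' q"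
    using lm_exists[OF assms(1)] by blast
  then show "p \<in> MM" "psv_coeff f p \<noteq> 0" "\<And>q. psv_coeff f q \<noteq> 0 \<Longrightarrow> ge p q"
    using assms(2) by auto
qed

lemma lm_None_iff: "lm gt f = None \<longleftrightarrow> f = 0"
  by (simp add: lm_def)

lemma lm_le_iff:
  assumes f: "f \<in> Rxs m n s" and p: "p \<in> MM"
  shows "lm_le gt (lm gt f) (Some p) \<longleftrightarrow> (\<forall>q. psv_coeff f q \<noteq> 0 \<longrightarrow> ge p q)"
proof (cases "f = 0")
  case True
  then show ?thesis by (simp add: lm_def)
next
  case False
  then obtain w where w: "lm gt f = Some w" "w \<in> MM" "psv_coeff f w \<noteq> 0" "\<And>q. psv_coeff f q \<noteq> 0 \<Longrightarrow> ge w q"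
    using lm_exists[OF f] by blast
  have "(\<forall>q. psv_coeff f q \<noteq> 0 \<longrightarrow> ge p q) \<longleftrightarrow> ge p w"
    using w p f ge_trans unfolding Rxs_iff by blast
  then show ?thesis using w(1) by (auto simp: ge_def)
qed

lemma psp_top:
  assumes "u \<in> Rx m n" "u \<noteq> 0"
  obtains p where "p \<in> M0" "psp_coeff u p \<noteq> 0" "\<And>q. psp_coeff u q \<noteq> 0 \<Longrightarrow> q \<noteq> p \<Longrightarrow> gt0 p q"
proof -
  let ?A = "{p. psp_coeff u p \<noteq> 0}"
  have A: "?A \<subseteq> M0" using assms(1) by (auto simp: Rx_iff)
  have "?A \<noteq> {}" using assms(2) psp_eq_iff[of u 0] by auto
  moreover obtain D where "\<forall>p. psp_coeff u p \<noteq> 0 \<longrightarrow> xdeg n p \<le> D"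
    using psp_xdeg_bound by blast
  ultimately obtain p where p: "p \<in> ?A" "\<forall>q\<in>?A. q \<noteq> p \<longrightarrow> gt0 p q"
    using has_greatest_gt0[OF A, of D] by blast
  then show thesis using that[of p] A by auto
qed

lemma greatest_in_psp:
  assumes "u \<in> Rx m n" "psp_coeff u p \<noteq> 0" "\<And>q. psp_coeff u q \<noteq> 0 \<Longrightarrow> q \<noteq> p \<Longrightarrow> gt0 p q"
  shows "greatest_in gt0 {p. psp_coeff u p \<noteq> 0} = p"
  using assms strict_total_on_subset[OF gt0_total_on, of "{p. psp_coeff u p \<noteq> 0}"]
  by (intro greatest_in_eqI) (auto simp: Rx_iff)

text \<open>Because \<open>u \<noteq> 0\<close> has a greatest monomial, the description operator in \<open>lt_psp\<close> picks it.\<close>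

lemma S_gt_iff:
  "u \<in> S_gt m n gt0 \<longleftrightarrow> psp_coeff u 0 = 1 \<and> (\<forall>p. psp_coeff u p \<noteq> 0 \<and> p \<noteq> 0 \<longrightarrow> p \<in> M0 \<and> gt0 0 p)"
    (is "?l \<longleftrightarrow> ?r")
proof
  assume ?l
  then have u: "u \<in> Rx m n" "lt_psp gt0 u = 1" by (auto simp: S_gt_def)
  then have "u \<noteq> 0" by (auto simp: lt_psp_def)
  obtain p where p: "psp_coeff u p \<noteq> 0" "\<And>q. psp_coeff u q \<noteq> 0 \<Longrightarrow> q \<noteq> p \<Longrightarrow> gt0 p q"
    using psp_top[OF u(1) \<open>u \<noteq> 0\<close>] by blast
  have "mon_term p (psp_coeff u p) = 1"
    using u(2) \<open>u \<noteq> 0\<close> greatest_in_psp[OF u(1) p] by (simp add: lt_psp_def Let_def)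
  then have "psp_coeff (mon_term p (psp_coeff u p)) 0 = 1" by simp
  then have "p = 0" "psp_coeff u p = 1" by (auto split: if_splits)
  then show ?r using p u by (auto simp: Rx_iff)
next
  assume r: ?r
  then have u: "u \<in> Rx m n" unfolding Rx_iff by (metis zero_in_Mon)
  have "greatest_in gt0 {p. psp_coeff u p \<noteq> 0} = 0"
    using r by (intro greatest_in_psp[OF u]) auto
  moreover have "mon_term 0 1 = (1 :: 'a psp)" by (simp add: psp_eq_iff)
  moreover have "u \<noteq> 0" using r by auto
  ultimately show ?l using u r by (simp add: S_gt_def lt_psp_def Let_def)
qed

text \<open>Every product of a term of \<open>u\<close> and a term of \<open>f\<close> other than \<open>(p, w)\<close> is strictly smaller than
  the product of \<open>p\<close> and \<open>w\<close>, so nothing cancels the latter.\<close>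

lemma lm_smult:
  fixes f :: "'k::field psv"
  assumes u: "u \<in> Rx m n" "psp_coeff u p \<noteq> 0" "\<And>q. psp_coeff u q \<noteq> 0 \<Longrightarrow> q \<noteq> p \<Longrightarrow> gt0 p q"
    and f: "f \<in> Rxs m n s" "lm gt f = Some w"
  shows "lm gt (u \<odot> f) = Some (mon_act p w)"
    and "psv_coeff (u \<odot> f) (mon_act p w) = psp_coeff u p * psv_coeff f w"
proof -
  obtain w0 i where wi: "w = (w0, i)" by (cases w)
  note F = lm_SomeD[OF f]
  have less: "gt (p + w0, i) (a + b, j)"
    if "psp_coeff u a \<noteq> 0" "psv_coeff f (b, j) \<noteq> 0" "(a, b, j) \<noteq> (p, w0, i)" for a b j
  proof -
    have M: "p \<in> M0" "a \<in> M0" "(b, j) \<in> MM" "(w0, i) \<in> MM"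
      using u f(1) that F(2) wi by (auto simp: Rx_iff Rxs_iff)
    have 1: "ge (mon_act p w) (mon_act p (b, j))"
      using F(2) F(4)[OF that(2)] M by (intro ge_act) auto
    show ?thesis
    proof (cases "a = p")
      case True
      then have "gt w (b, j)" using F(4)[OF that(2)] that(3) wi by (auto simp: ge_def)
      then have "gt (mon_act p w) (mon_act p (b, j))" using M wi by (intro gt_act) auto
      then show ?thesis using True wi by simp
    next
      case False
      then have "gt (mon_act p (b, j)) (mon_act a (b, j))"
        using u that M by (intro gt_act0) auto
      then have "gt (mon_act p w) (mon_act a (b, j))"
        using 1 M wi by (intro ge_gt_trans[OF 1]) auto
      then show ?thesis using wi by simp
    qed
  qed
  have "psv_coeff (u \<odot> f) (p + w0, i) = (\<Sum>(a, b)\<in>{(p, w0)}. psp_coeff u a * psv_coeff f (b, i))"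
    unfolding psv_coeff_smult
  proof (rule sum.mono_neutral_right)
    show "\<forall>x\<in>decomps (p + w0) - {(p, w0)}. (case x of (a, b) \<Rightarrow> psp_coeff u a * psv_coeff f (b, i)) = 0"
    proof (rule ballI, rule ccontr)
      fix x assume x: "x \<in> decomps (p + w0) - {(p, w0)}" "(case x of (a, b) \<Rightarrow> psp_coeff u a * psv_coeff f (b, i)) \<noteq> 0"
      obtain a b where ab: "x = (a, b)" by (cases x)
      have "gt (p + w0, i) (a + b, i)" using x ab by (intro less) auto
      moreover have "a + b = p + w0" using x ab by (auto simp: decomps_def)
      moreover have "(p + w0, i) \<in> MM" using u F wi by (auto simp: Rx_iff)
      ultimately show False using gt_irrefl by metis
    qed
    show "{(p, w0)} \<subseteq> decomps (p + w0)" by (simp add: decomps_def)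
  qed simp
  then show c: "psv_coeff (u \<odot> f) (mon_act p w) = psp_coeff u p * psv_coeff f w"
    using wi by simp
  show "lm gt (u \<odot> f) = Some (mon_act p w)"
  proof (rule lm_eqI)
    show "u \<odot> f \<in> Rxs m n s" using u f by (intro Rxs_smult)
    show "psv_coeff (u \<odot> f) (mon_act p w) \<noteq> 0" using c u F by simp
    fix q assume q: "psv_coeff (u \<odot> f) q \<noteq> 0"
    obtain q0 j where qj: "q = (q0, j)" by (cases q)
    then obtain a b where "a + b = q0" "psp_coeff u a \<noteq> 0" "psv_coeff f (b, j) \<noteq> 0"
      using q smult_coeff_nonzeroE by metis
    then show "ge (mon_act p w) q"
      using less[of a b j] qj wi by (cases "(a, b, j) = (p, w0, i)") (auto simp: ge_def)
  qed
qed

lemma lm_mon_term_smult: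
  fixes f :: "'k::field psv"
  assumes "p \<in> M0" "c \<noteq> 0" "f \<in> Rxs m n s" "lm gt f = Some w"
  shows "lm gt (mon_term p c \<odot> f) = Some (mon_act p w)"
    and "psv_coeff (mon_term p c \<odot> f) (mon_act p w) = c * psv_coeff f w"
  using lm_smult[of "mon_term p c" p f w] assms by (auto simp: Rx_mon_term split: if_splits)

lemma lm_S_smult:
  fixes f :: "'k::field psv"
  assumes "u \<in> S_gt m n gt0" "f \<in> Rxs m n s"
  shows "lm gt (u \<odot> f) = lm gt f"
proof (cases "f = 0")
  case True
  then have "u \<odot> f = f" by (simp add: smult_vec_def fun_eq_iff)
  then show ?thesis by simp
next
  case False
  then obtain w where w: "lm gt f = Some w" using lm_exists[OF assms(2)] by blast
  have "lm gt (u \<odot> f) = Some (mon_act 0 w)"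
  proof (rule lm_smult[OF _ _ _ assms(2) w])
    show "u \<in> Rx m n" using assms(1) by (auto simp: S_gt_def)
  qed (use assms(1) in \<open>auto simp: S_gt_iff\<close>)
  then show ?thesis using w by (cases w) simp
qed

end

section \<open>Combinations with the smallest leading monomial\<close>

lemma smult_vec_simps:
  "(u + v) \<odot> f = u \<odot> f + v \<odot> f"
  "(u - v) \<odot> f = u \<odot> f - v \<odot> f"
  "(- u) \<odot> f = - (u \<odot> f)"
  "u \<odot> (f + g) = u \<odot> f + u \<odot> g"
  "u \<odot> (f - g) = u \<odot> f - u \<odot> g"
  "u \<odot> v \<odot> f = (u * v) \<odot> f"
  "1 \<odot> f = f"
  "0 \<odot> f = 0"
  "u \<odot> 0 = 0"
  by (auto simp: smult_vec_def fun_eq_iff algebra_simps)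

lemma smult_vec_sum: "u \<odot> sum f A = (\<Sum>a\<in>A. u \<odot> f a)"
  by (simp add: smult_vec_def fun_eq_iff sum_fun_apply sum_distrib_left)

text \<open>The coefficient of \<open>u f\<close> at a fixed monomial as a linear form in the coefficients of \<open>u\<close>, in which
  only the finitely many divisors of that monomial occur.\<close>

lemma psv_coeff_smult_expand:
  "psv_coeff (u \<odot> f) (w, i) =
    (\<Sum>p\<in>fst ` decomps w. psp_coeff u p * psv_coeff (mon_term p 1 \<odot> f) (w, i))"
proof -
  let ?P = "fst ` decomps w"
  have "(\<Sum>p\<in>?P. psp_coeff u p * psv_coeff (mon_term p 1 \<odot> f) (w, i))
    = (\<Sum>p\<in>?P. \<Sum>x\<in>decomps w. if p = fst x then psp_coeff u p * psv_coeff f (snd x, i) else 0)"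
    unfolding psv_coeff_smult sum_distrib_left
    by (intro sum.cong refl) (auto split: prod.splits)
  also have "\<dots> = (\<Sum>x\<in>decomps w. \<Sum>p\<in>?P. if p = fst x then psp_coeff u p * psv_coeff f (snd x, i) else 0)"
    by (rule sum.swap)
  also have "\<dots> = (\<Sum>x\<in>decomps w. psp_coeff u (fst x) * psv_coeff f (snd x, i))"
    by (intro sum.cong refl) (simp add: sum.delta)
  finally show ?thesis
    by (simp add: psv_coeff_smult case_prod_unfold)
qed

context t_local_ordering
begin

lemma finite_has_least:
  assumes "finite F" "F \<noteq> {}" "F \<subseteq> MM"
  shows "\<exists>w\<in>F. \<forall>w'\<in>F. ge w' w"
  using assms
proof (induction rule: finite_ne_induct)
  case (singleton w)
  then show ?case by (auto simp: ge_def)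
next
  case (insert v F)
  then obtain w where w: "w \<in> F" "\<forall>w'\<in>F. ge w' w" by auto
  show ?case
  proof (cases "ge v w")
    case True
    then show ?thesis using w by auto
  next
    case False
    then have "ge w v" using gt_total[of v w] w insert.prems by (auto simp: ge_def)
    moreover have "ge v v" by (simp add: ge_def)
    moreover have "ge w' v" if "w' \<in> F" for w'
      using ge_trans[of w' w v] w that insert.prems \<open>ge w v\<close> by blast
    ultimately show ?thesis by blast
  qed
qed

text \<open>
  Let \<open>C\<close> be the set of monomials above all terms of at least one admissible combination. For
  \<open>w \<in> C\<close> require that the coefficient at \<open>w\<close> vanishes. Finitely many of these requirements are met
  by the combination that belongs to the smallest of the monomials involved, so by compactness all
  of them can be met at once. No other combination can then have a smaller leading monomial, since the leading monomial of the solution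
  would belong to \<open>C\<close>.
\<close>

lemma minimal_combination:
  fixes f :: "'k::field psv" and h :: "nat \<Rightarrow> 'k psv" and A :: "nat \<Rightarrow> mon set"
  assumes A: "\<And>j p. j < N \<Longrightarrow> p \<in> A j \<Longrightarrow> p \<in> M0 \<and> xdeg n p \<le> D"
  shows "\<exists>Q. (\<forall>j<N. \<forall>p. psp_coeff (Q j) p \<noteq> 0 \<longrightarrow> p \<in> A j) \<and>
    (\<forall>Q' w. (\<forall>j<N. \<forall>p. psp_coeff (Q' j) p \<noteq> 0 \<longrightarrow> p \<in> A j) \<longrightarrow> w \<in> MM \<longrightarrow>
       (\<forall>p. psv_coeff (f + (\<Sum>j<N. Q' j \<odot> h j)) p \<noteq> 0 \<longrightarrow> gt w p) \<longrightarrow>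
       psv_coeff (f + (\<Sum>j<N. Q j \<odot> h j)) w = 0)"
proof -
  define adm where "adm Q \<longleftrightarrow> (\<forall>j<N. \<forall>p. psp_coeff (Q j) p \<noteq> 0 \<longrightarrow> p \<in> A j)" for Q :: "nat \<Rightarrow> 'k psp"
  define cmb where "cmb Q = f + (\<Sum>j<N. Q j \<odot> h j)" for Q
  define C where "C = {w \<in> MM. \<exists>Q. adm Q \<and> (\<forall>p. psv_coeff (cmb Q) p \<noteq> 0 \<longrightarrow> gt w p)}"
  \<comment> \<open>The unknowns are the pairs \<open>(j, p)\<close>, standing for the coefficient of \<open>Q j\<close> at \<open>p\<close>; the matrix entry is
    the contribution of the monomial \<open>p\<close> in \<open>Q j\<close> to the coefficient at \<open>w\<close>.\<close>
  define a where "a w = (\<lambda>(j, p). if j < N \<and> p \<in> A j then psv_coeff (mon_term p 1 \<odot> h j) w else 0)" for w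
  have supp: "{x. a w x \<noteq> 0} \<subseteq> {..<N} \<times> fst ` decomps (fst w)" for w
  proof safe
    fix j p assume nz: "a w (j, p) \<noteq> 0"
    then show "j < N" by (auto simp: a_def split: if_splits)
    from nz have "psv_coeff (mon_term p 1 \<odot> h j) (fst w, snd w) \<noteq> 0"
      by (auto simp: a_def split: if_splits)
    then obtain x y where "x + y = fst w" "psp_coeff (mon_term p (1::'k)) x \<noteq> 0"
      by (rule smult_coeff_nonzeroE)
    then have "(p, y) \<in> decomps (fst w)"
      by (auto simp: decomps_def split: if_splits)
    then show "p \<in> fst ` decomps (fst w)"
      by force
  qed
  have eqn: "(\<Sum>x | a w x \<noteq> 0. a w x * v x) = psv_coeff (\<Sum>j<N. Q j \<odot> h j) w"
    if "\<And>j p. j < N \<Longrightarrow> psp_coeff (Q j) p = (if p \<in> A j then v (j, p) else 0)" for Q v w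
  proof -
    let ?P = "fst ` decomps (fst w)"
    have "(\<Sum>x | a w x \<noteq> 0. a w x * v x) = (\<Sum>x\<in>{..<N} \<times> ?P. a w x * v x)"
      by (rule sum.mono_neutral_left) (use supp in auto)
    also have "\<dots> = (\<Sum>j<N. \<Sum>p\<in>?P. psp_coeff (Q j) p * psv_coeff (mon_term p 1 \<odot> h j) w)"
      unfolding sum.cartesian_product by (intro sum.cong refl) (auto simp: a_def that)
    also have "\<dots> = (\<Sum>j<N. psv_coeff (Q j \<odot> h j) w)"
      using psv_coeff_smult_expand[of "Q _" "h _" "fst w" "snd w"] by simp
    finally show ?thesis by simp
  qed
  have "\<exists>v. \<forall>w\<in>C. (\<Sum>x | a w x \<noteq> 0. a w x * v x) = - psv_coeff f w"
  proof (rule linear_system_compact)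
    show "finite {x. a w x \<noteq> 0}" for w
      by (rule finite_subset[OF supp]) simp
  next
    fix F assume F: "finite F" "F \<subseteq> C"
    show "\<exists>v. \<forall>w\<in>F. (\<Sum>x | a w x \<noteq> 0. a w x * v x) = - psv_coeff f w"
    proof (cases "F = {}")
      case False
      have "F \<subseteq> MM" using F by (auto simp: C_def)
      then obtain w0 where w0: "w0 \<in> F" "\<forall>w\<in>F. ge w w0"
        using finite_has_least[OF F(1) False] by blast
      then obtain Q where Q: "adm Q" "\<And>p. psv_coeff (cmb Q) p \<noteq> 0 \<Longrightarrow> gt w0 p"
        using F by (auto simp: C_def)
      have "psv_coeff (cmb Q) w = 0" if "w \<in> F" for w
      proof (rule ccontr)
        assume "psv_coeff (cmb Q) w \<noteq> 0"
        then have "gt w0 w" by (rule Q)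
        then have "gt w w"
          using ge_gt_trans[of w w0 w] w0 that \<open>F \<subseteq> MM\<close> by blast
        then show False using gt_irrefl that \<open>F \<subseteq> MM\<close> by blast
      qed
      moreover have "(\<Sum>x | a w x \<noteq> 0. a w x * psp_coeff (Q (fst x)) (snd x)) = psv_coeff (\<Sum>j<N. Q j \<odot> h j) w" for w
        by (rule eqn) (use Q(1) in \<open>auto simp: adm_def\<close>)
      ultimately show ?thesis
        by (intro exI[of _ "\<lambda>x. psp_coeff (Q (fst x)) (snd x)"])
          (simp add: cmb_def add_eq_0_iff)
    qed auto
  qed
  then obtain v where v: "\<And>w. w \<in> C \<Longrightarrow> (\<Sum>x | a w x \<noteq> 0. a w x * v x) = - psv_coeff f w"
    by blast
  have "\<exists>u. \<forall>p. psp_coeff u p = (if p \<in> A j then v (j, p) else 0)" if "j < N" for j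
    using psp_of_coeffs[of "\<lambda>p. if p \<in> A j then v (j, p) else 0" m n D] A[OF that] by metis
  then obtain Q where Q: "\<And>j p. j < N \<Longrightarrow> psp_coeff (Q j) p = (if p \<in> A j then v (j, p) else 0)"
    by metis
  have "adm Q" using Q by (auto simp: adm_def split: if_splits)
  moreover have "psv_coeff (cmb Q) w = 0" if "w \<in> C" for w
    using v[OF that] eqn[OF Q, where w = w] by (simp add: cmb_def)
  ultimately show ?thesis
    unfolding C_def adm_def cmb_def by blast
qed

lemma cancel_leading:
  fixes f g :: "'k::field psv"
  assumes "f \<in> Rxs m n s" "lm gt f = Some w" "g \<in> Rxs m n s" "lm gt g = Some w"
    and "psv_coeff f w = psv_coeff g w" "psv_coeff (f - g) p \<noteq> 0"
  shows "gt w p"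
proof -
  have "psv_coeff f p \<noteq> 0 \<or> psv_coeff g p \<noteq> 0" using assms(6) by auto
  then have "ge w p" using lm_SomeD(4)[OF assms(1,2)] lm_SomeD(4)[OF assms(3,4)] by blast
  moreover have "p \<noteq> w" using assms(5,6) by auto
  ultimately show ?thesis by (auto simp: ge_def)
qed

section \<open>Weak division with remainder\<close>

lemma mon_term_mult_coeff_nonzeroE:
  assumes "psp_coeff (mon_term a c * u) p \<noteq> 0"
  obtains b where "p = a + b" "psp_coeff u b \<noteq> 0"
proof -
  obtain x y where "(x, y) \<in> decomps p" "psp_coeff (mon_term a c) x * psp_coeff u y \<noteq> 0"
    using assms unfolding psp_coeff_mult by (auto elim: sum.not_neutral_contains_not_neutral)
  then show ?thesis by (intro that[of y]) (auto simp: decomps_def split: if_splits)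
qed

text \<open>Mora's division with the infinite reductions replaced by the choice of minimal remainders.\<close>

theorem weak_division_exists:
  fixes f :: "'k::field psv"
  assumes f: "f \<in> Rxs m n s" and gs: "set gs \<subseteq> Rxs m n s"
  shows "\<exists>u q r. weak_division m n s gt gt0 gs f u q r"
proof (cases "f = 0")
  case True
  have "weak_division m n s gt gt0 gs f 1 (\<lambda>_. 0) 0"
    using True by (simp add: weak_division_def S_gt_iff smult_vec_simps lm_def)
  then show ?thesis by blast
next
  case False
  obtain l where l: "lm gt f = Some l" "l \<in> MM" "\<And>w. psv_coeff f w \<noteq> 0 \<Longrightarrow> ge l w"
    using lm_exists[OF f False] by metis
  define k where "k = length gs"
  have g: "gs ! i \<in> Rxs m n s" if "i < k" for i
    using gs that by (auto simp: k_def)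
  \<comment> \<open>\<open>ok D i p\<close>: the monomial \<open>p\<close> may occur in the quotient \<open>q i\<close>. Asking \<open>l \<ge> p w\<close> of all terms \<open>w\<close>
    of \<open>g\<^sub>i\<close> makes the bound on \<open>lm (q\<^sub>i g\<^sub>i)\<close> a condition on the support of \<open>q i\<close>, hence linear.\<close>
  define ok where "ok D i p \<longleftrightarrow> p \<in> M0 \<and> xdeg n p \<le> D \<and>
      (\<forall>w. psv_coeff (gs ! i) w \<noteq> 0 \<longrightarrow> ge l (mon_act p w))" for D i p
  define adm where "adm D u q \<longleftrightarrow> psp_coeff u 0 = 1 \<and>
      (\<forall>p. p \<noteq> 0 \<and> psp_coeff u p \<noteq> 0 \<longrightarrow> p \<in> M0 \<and> xdeg n p \<le> D \<and> gt0 0 p) \<and>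
      (\<forall>i<k. \<forall>p. psp_coeff (q i) p \<noteq> 0 \<longrightarrow> ok D i p)" for D and u :: "'k psp" and q :: "nat \<Rightarrow> 'k psp"
  define res where "res u q = u \<odot> f - (\<Sum>i<k. q i \<odot> gs ! i)" for u :: "'k psp" and q :: "nat \<Rightarrow> 'k psp"
  \<comment> \<open>Terms of a remainder are at most \<open>l\<close>, and their \<open>x\<close>-degree exceeds \<open>D\<close> at most by that of a
    monomial of \<open>f\<close> or of some \<open>g\<^sub>i\<close>.\<close>
  have res_nz: "ge l w \<and> (\<exists>a b. fst w = a + b \<and> xdeg n a \<le> D \<and>
        (psv_coeff f (b, snd w) \<noteq> 0 \<or> (\<exists>i<k. psv_coeff (gs ! i) (b, snd w) \<noteq> 0)))"
    if adm: "adm D u q" and nz: "psv_coeff (res u q) w \<noteq> 0" for D u q w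
  proof -
    obtain w0 i where w: "w = (w0, i)" by (cases w)
    have "psv_coeff (u \<odot> f) w \<noteq> 0 \<or> (\<exists>j<k. psv_coeff (q j \<odot> gs ! j) w \<noteq> 0)"
    proof (rule ccontr)
      assume "\<not> ?thesis"
      then have "psv_coeff (res u q) w = 0" by (simp add: res_def)
      then show False using nz by simp
    qed
    then consider "psv_coeff (u \<odot> f) w \<noteq> 0" | j where "j < k" "psv_coeff (q j \<odot> gs ! j) w \<noteq> 0"
      by blast
    then show ?thesis
    proof cases
      case 1
      then obtain a b where ab: "a + b = w0" "psp_coeff u a \<noteq> 0" "psv_coeff f (b, i) \<noteq> 0"
        unfolding w by (rule smult_coeff_nonzeroE)
      have b: "(b, i) \<in> MM" using ab f by (auto simp: Rxs_iff)
      have a: "a = 0 \<or> (a \<in> M0 \<and> xdeg n a \<le> D \<and> gt0 0 a)"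
        using adm ab by (auto simp: adm_def)
      have "ge (b, i) w"
        using a gt_act0[of 0 a "(b, i)"] b ab(1) w by (auto simp: ge_def)
      then have "ge l w"
        by (rule ge_trans[OF l(3)[OF ab(3)] _ l(2) b]) (use a b ab(1) w in auto)
      moreover have "xdeg n a \<le> D" using a by auto
      ultimately show ?thesis
        using ab w by (intro conjI exI[of _ a] exI[of _ b]) simp_all
    next
      case (2 j)
      then obtain a b where ab: "a + b = w0" "psp_coeff (q j) a \<noteq> 0" "psv_coeff (gs ! j) (b, i) \<noteq> 0"
        unfolding w by (blast elim: smult_coeff_nonzeroE)
      then have "ok D j a" using adm 2 by (auto simp: adm_def)
      then have "ge l (mon_act a (b, i))" "xdeg n a \<le> D" using ab by (auto simp: ok_def)
      then show ?thesis
        using ab w 2 by (intro conjI exI[of _ a] exI[of _ b]) auto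
    qed
  qed
  have adm_Rx: "u \<in> Rx m n" "\<And>i. i < k \<Longrightarrow> q i \<in> Rx m n" "res u q \<in> Rxs m n s" if "adm D u q" for D u q
  proof -
    show u: "u \<in> Rx m n" using that unfolding Rx_iff adm_def by (metis zero_in_Mon)
    show q: "\<And>i. i < k \<Longrightarrow> q i \<in> Rx m n" using that unfolding Rx_iff adm_def ok_def by blast
    show "res u q \<in> Rxs m n s"
      unfolding res_def using u q f g by (intro Rxs_diff Rxs_sum Rxs_smult) auto
  qed
  \<comment> \<open>A minimal remainder for each \<open>D\<close>. The vector \<open>f\<close> enters with coefficient \<open>1 + Q 0\<close>, where all
    monomials of \<open>Q 0\<close> are smaller than \<open>1\<close>; the quotients are \<open>- Q (Suc i)\<close>.\<close>
  have "\<exists>u q. adm D u q \<and> (\<forall>u' q' w. adm D u' q' \<longrightarrow> w \<in> MM \<longrightarrow>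
      (\<forall>p. psv_coeff (res u' q') p \<noteq> 0 \<longrightarrow> gt w p) \<longrightarrow> psv_coeff (res u q) w = 0)" for D
  proof -
    define h where "h j = (case j of 0 \<Rightarrow> f | Suc i \<Rightarrow> gs ! i)" for j
    define A where "A j = (case j of 0 \<Rightarrow> {p \<in> M0. xdeg n p \<le> D \<and> gt0 0 p} | Suc i \<Rightarrow> {p. ok D i p})" for j
    have eq: "f + (\<Sum>j<Suc k. Q j \<odot> h j) = res (1 + Q 0) (\<lambda>i. - Q (Suc i))" for Q
      by (simp add: sum.lessThan_Suc_shift h_def res_def smult_vec_simps sum_negf del: sum.lessThan_Suc)
    have adm_iff: "adm D (1 + Q 0) (\<lambda>i. - Q (Suc i)) \<longleftrightarrow> (\<forall>j<Suc k. \<forall>p. psp_coeff (Q j) p \<noteq> 0 \<longrightarrow> p \<in> A j)"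
      for Q
    proof -
      have "(\<forall>p. psp_coeff (Q 0) p \<noteq> 0 \<longrightarrow> p \<in> A 0) \<longleftrightarrow> psp_coeff (Q 0) 0 = 0 \<and>
          (\<forall>p. p \<noteq> 0 \<and> psp_coeff (Q 0) p \<noteq> 0 \<longrightarrow> p \<in> M0 \<and> xdeg n p \<le> D \<and> gt0 0 p)"
        using gt0_irrefl[OF zero_in_Mon] unfolding A_def nat.case mem_Collect_eq by metis
      then show ?thesis
        unfolding All_less_Suc2 adm_def by (simp add: A_def cong: conj_cong)
    qed
    have "\<exists>Q. (\<forall>j<Suc k. \<forall>p. psp_coeff (Q j) p \<noteq> 0 \<longrightarrow> p \<in> A j) \<and>
      (\<forall>Q' w. (\<forall>j<Suc k. \<forall>p. psp_coeff (Q' j) p \<noteq> 0 \<longrightarrow> p \<in> A j) \<longrightarrow> w \<in> MM \<longrightarrow>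
       (\<forall>p. psv_coeff (f + (\<Sum>j<Suc k. Q' j \<odot> h j)) p \<noteq> 0 \<longrightarrow> gt w p) \<longrightarrow>
       psv_coeff (f + (\<Sum>j<Suc k. Q j \<odot> h j)) w = 0)"
      by (rule minimal_combination[where D = D]) (auto simp: A_def ok_def split: nat.splits)
    then obtain Q where Q: "adm D (1 + Q 0) (\<lambda>i. - Q (Suc i))"
      and min: "\<And>Q' w. adm D (1 + Q' 0) (\<lambda>i. - Q' (Suc i)) \<Longrightarrow> w \<in> MM \<Longrightarrow>
        (\<forall>p. psv_coeff (res (1 + Q' 0) (\<lambda>i. - Q' (Suc i))) p \<noteq> 0 \<longrightarrow> gt w p) \<Longrightarrow>
        psv_coeff (res (1 + Q 0) (\<lambda>i. - Q (Suc i))) w = 0"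
      unfolding eq adm_iff[symmetric] by blast
    show ?thesis
    proof (intro exI conjI allI impI)
      fix u' q' w
      assume "adm D u' q'" "w \<in> MM" "\<forall>p. psv_coeff (res u' q') p \<noteq> 0 \<longrightarrow> gt w p"
      then show "psv_coeff (res (1 + Q 0) (\<lambda>i. - Q (Suc i))) w = 0"
        using min[of "\<lambda>j. case j of 0 \<Rightarrow> u' - 1 | Suc i \<Rightarrow> - q' i" w] by simp
    qed (rule Q)
  qed
  then obtain U Q where UQ: "\<And>D. adm D (U D) (Q D)"
    and min: "\<And>D u' q' w. adm D u' q' \<Longrightarrow> w \<in> MM \<Longrightarrow>
      (\<And>p. psv_coeff (res u' q') p \<noteq> 0 \<Longrightarrow> gt w p) \<Longrightarrow> psv_coeff (res (U D) (Q D)) w = 0"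
    by metis
  define r where "r D = res (U D) (Q D)" for D
  note r_Rxs = adm_Rx(3)[OF UQ, folded r_def]
  show ?thesis
  proof (cases "\<exists>D. r D \<noteq> 0 \<longrightarrow> (\<forall>i<k. \<not> lm_dvd (lm gt (gs ! i)) (lm gt (r D)))")
    case True
    then obtain D where D: "r D \<noteq> 0 \<longrightarrow> (\<forall>i<k. \<not> lm_dvd (lm gt (gs ! i)) (lm gt (r D)))" by blast
    have "U D \<in> S_gt m n gt0"
      using UQ[of D] by (auto simp: S_gt_iff adm_def)
    moreover have "lm_le gt (lm gt (Q D i \<odot> gs ! i)) (lm gt f)" if i: "i < k" for i
    proof -
      have "ge l w" if nz: "psv_coeff (Q D i \<odot> gs ! i) w \<noteq> 0" for w
      proof -
        obtain w0 j where w: "w = (w0, j)" by (cases w)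
        obtain a b where "a + b = w0" "psp_coeff (Q D i) a \<noteq> 0" "psv_coeff (gs ! i) (b, j) \<noteq> 0"
          using nz unfolding w by (rule smult_coeff_nonzeroE)
        then show ?thesis using UQ[of D] i w unfolding adm_def ok_def by force
      qed
      then show ?thesis
        unfolding l(1) using i by (subst lm_le_iff) (auto intro!: Rxs_smult adm_Rx(2)[OF UQ] g l(2))
    qed
    ultimately have "weak_division m n s gt gt0 gs f (U D) (Q D) (r D)"
      using D adm_Rx(2)[OF UQ[of D]] adm_Rx(3)[OF UQ[of D]] unfolding weak_division_def r_def k_def[symmetric]
      by (simp add: res_def)
    then show ?thesis by blast
  next
    case False
    then have nz: "r D \<noteq> 0" and red: "\<exists>i<k. lm_dvd (lm gt (gs ! i)) (lm gt (r D))" for D by auto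
    have "\<exists>t. lm gt (r D) = Some t" for D
      using lm_exists[OF r_Rxs nz] by metis
    then obtain t where t: "\<And>D. lm gt (r D) = Some (t D)" by metis
    note T = lm_SomeD[OF r_Rxs t]
    have minr: "\<exists>p. psv_coeff (res u' q') p \<noteq> 0 \<and> \<not> gt (t D) p" if "adm D u' q'" for D u' q'
      using min[OF that T(2)[of D]] T(3)[of D] unfolding r_def by blast
    \<comment> \<open>Reducing \<open>r D\<close> by some \<open>g\<^sub>i\<close> raises the degree bound but gives a smaller leading monomial.\<close>
    have "\<exists>D'>D. gt (t D) (t D')" for D
    proof -
      obtain i where i: "i < k" "lm_dvd (lm gt (gs ! i)) (lm gt (r D))" using red by blast
      then obtain w a where w: "lm gt (gs ! i) = Some w" and a: "t D = mon_act a w"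
        unfolding t by (cases "lm gt (gs ! i)") (auto simp: mmon_dvd_def)
      note W = lm_SomeD[OF g[OF i(1)] w]
      have aM: "a \<in> M0" using T(2)[of D] a by simp
      define D' where "D' = max (Suc D) (xdeg n a)"
      define c where "c = psv_coeff (r D) (t D) / psv_coeff (gs ! i) w"
      have c: "c \<noteq> 0" "c * psv_coeff (gs ! i) w = psv_coeff (r D) (t D)"
        using W(3) T(3)[of D] by (auto simp: c_def)
      define q' where "q' = (Q D)(i := Q D i + mon_term a c)"
      have lt: "ge l (t D)" using res_nz[OF UQ, of D "t D"] T(3)[of D] by (simp add: r_def)
      have "ge l (mon_act a v)" if "psv_coeff (gs ! i) v \<noteq> 0" for v
      proof -
        have v: "v \<in> MM" using that g[OF i(1)] by (auto simp: Rxs_iff)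
        have "ge (t D) (mon_act a v)"
          unfolding a by (rule ge_act[OF W(4)[OF that] W(2) v aM])
        then show ?thesis
          by (rule ge_trans[OF lt _ l(2) T(2)]) (simp add: v aM)
      qed
      then have "ok D' i a" using aM by (simp add: ok_def D'_def)
      moreover have "ok D' j p" if "ok D j p" for j p using that by (auto simp: ok_def D'_def)
      ultimately have "adm D' (U D) q'"
        using UQ[of D] unfolding adm_def q'_def by (auto simp: D'_def split: if_splits; metis add.right_neutral add_0)
      then obtain p where p: "psv_coeff (res (U D) q') p \<noteq> 0" "\<not> gt (t D') p"
        using minr by blast
      have "(\<Sum>j<k. q' j \<odot> gs ! j) = (\<Sum>j<k. Q D j \<odot> gs ! j) + mon_term a c \<odot> gs ! i"
      proof -
        have "(\<Sum>j<k. q' j \<odot> gs ! j) = (\<Sum>j<k. Q D j \<odot> gs ! j + (if j = i then mon_term a c \<odot> gs ! i else 0))"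
          by (intro sum.cong refl) (auto simp: q'_def smult_vec_simps)
        also have "\<dots> = (\<Sum>j<k. Q D j \<odot> gs ! j) + mon_term a c \<odot> gs ! i"
          using i(1) by (simp add: sum.distrib)
        finally show ?thesis .
      qed
      then have res': "res (U D) q' = r D - mon_term a c \<odot> gs ! i"
        by (simp add: res_def r_def)
      have "gt (t D) p"
      proof (rule cancel_leading[OF r_Rxs t])
        show "lm gt (mon_term a c \<odot> gs ! i) = Some (t D)"
          using lm_mon_term_smult(1)[OF aM c(1) g[OF i(1)] w] a by simp
        show "psv_coeff (r D) (t D) = psv_coeff (mon_term a c \<odot> gs ! i) (t D)"
          using lm_mon_term_smult(2)[OF aM c(1) g[OF i(1)] w] a c by simp
      qed (use p res' aM i g in \<open>auto intro!: Rxs_smult Rx_mon_term\<close>)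
      moreover have "p \<in> MM"
        using p(1) adm_Rx(3)[OF \<open>adm D' (U D) q'\<close>] by (auto simp: Rxs_iff)
      then have "ge p (t D')" using gt_total[of p "t D'"] p(2) T(2)[of D'] by (auto simp: ge_def)
      ultimately have "gt (t D) (t D')" using gt_ge_trans[of "t D" p "t D'"] T(2) \<open>p \<in> MM\<close> by blast
      then show ?thesis by (intro exI[of _ D']) (auto simp: D'_def)
    qed
    then obtain nxt where nxt: "\<And>D. D < nxt D" "\<And>D. gt (t D) (t (nxt D))" by metis
    \<comment> \<open>A sequence of degree bounds along which the leading monomials decrease strictly.\<close>
    define d where "d i = (nxt ^^ i) 0" for i
    have d: "d i < d j \<and> gt (t (d i)) (t (d j))" if "i < j" for i j
      using that
    proof (induction rule: less_Suc_induct)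
      case (1 i) then show ?case using nxt by (simp add: d_def)
    next
      case (2 i j k) then show ?case using gt_trans T(2) by (meson less_trans)
    qed
    \<comment> \<open>The constant that keeps the truncated subtraction \<open>D + C - xdeg n (fst (t D))\<close> exact.\<close>
    obtain C where C: "xdeg n (fst (t D)) \<le> D + C" for D
    proof -
      obtain C0 where C0: "\<And>p. psv_coeff f p \<noteq> 0 \<Longrightarrow> xdeg n (fst p) \<le> C0"
        using psv_xdeg_bound[OF f] by blast
      have "\<forall>i. \<exists>C. i < k \<longrightarrow> (\<forall>p. psv_coeff (gs ! i) p \<noteq> 0 \<longrightarrow> xdeg n (fst p) \<le> C)"
        using psv_xdeg_bound[OF g] by blast
      then obtain C1 where C1: "\<And>i p. i < k \<Longrightarrow> psv_coeff (gs ! i) p \<noteq> 0 \<Longrightarrow> xdeg n (fst p) \<le> C1 i"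
        by metis
      have "xdeg n (fst (t D)) \<le> D + (C0 + (\<Sum>i<k. C1 i))" for D
      proof -
        obtain a b where ab: "fst (t D) = a + b" "xdeg n a \<le> D"
          "psv_coeff f (b, snd (t D)) \<noteq> 0 \<or> (\<exists>i<k. psv_coeff (gs ! i) (b, snd (t D)) \<noteq> 0)"
          using res_nz[OF UQ, of D "t D"] T(3)[of D] unfolding r_def by blast
        have "C1 i \<le> (\<Sum>i<k. C1 i)" if "i < k" for i
          using that by (intro member_le_sum) auto
        then have "xdeg n b \<le> C0 + (\<Sum>i<k. C1 i)"
          using ab(3) C0[of "(b, snd (t D))"] C1[of _ "(b, snd (t D))"] by force
        then show ?thesis using ab by simp
      qed
      then show thesis by (rule that)
    qed
    \<comment> \<open>Dickson's lemma with the homogenising coordinate: the quotient \<open>a\<close> of the two leading monomials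
      has \<open>x\<close>-degree at most \<open>d j - d i\<close>.\<close>
    obtain i j a where ij: "i < j" and aM: "a \<in> M0" and tj: "t (d j) = mon_act a (t (d i))"
      and "\<And>c. c \<in> {\<lambda>k. d k + C - xdeg n (fst (t (d k)))} \<Longrightarrow> c i \<le> c j"
      by (rule mmon_dickson[of "{\<lambda>k. d k + C - xdeg n (fst (t (d k)))}" "\<lambda>k. t (d k)" m n s])
        (simp_all add: T(2))
    then have "d i + C - xdeg n (fst (t (d i))) \<le> d j + C - xdeg n (fst (t (d j)))" by simp
    moreover have "xdeg n (fst (t (d j))) = xdeg n a + xdeg n (fst (t (d i)))"
      using tj by (cases "t (d i)") simp
    ultimately have deg: "xdeg n a + d i \<le> d j"
      using C[of "d i"] C[of "d j"] by linarith
    have dij: "gt (t (d i)) (t (d j))" using d[OF ij] by simp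
    have a0: "gt0 0 a"
    proof (rule ccontr)
      assume "\<not> gt0 0 a"
      then have "a = 0 \<or> gt0 a 0" using gt0_total[of 0 a] aM by auto
      then have "ge (t (d j)) (t (d i))"
        using tj gt_act0[of a 0 "t (d i)"] aM T(2)[of "d i"]
        by (cases "t (d i)") (auto simp: ge_def)
      then show False using gt_ge_trans[OF dij] gt_irrefl T(2) by blast
    qed
    \<comment> \<open>Reduce the later remainder by the earlier one.\<close>
    define c where "c = psv_coeff (r (d j)) (t (d j)) / psv_coeff (r (d i)) (t (d i))"
    have c: "c \<noteq> 0" "c * psv_coeff (r (d i)) (t (d i)) = psv_coeff (r (d j)) (t (d j))"
      using T(3) by (auto simp: c_def)
    define u' where "u' = U (d j) - mon_term a c * U (d i)"
    define q' where "q' i' = Q (d j) i' - mon_term a c * Q (d i) i'" for i'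
    have "adm (d j) u' q'"
      unfolding adm_def
    proof (intro conjI allI impI)
      have "psp_coeff (mon_term a c * U (d i)) p \<noteq> 0 \<Longrightarrow> p \<in> M0 \<and> xdeg n p \<le> d j \<and> gt0 0 p" for p
      proof -
        assume "psp_coeff (mon_term a c * U (d i)) p \<noteq> 0"
        then obtain b where b: "p = a + b" "psp_coeff (U (d i)) b \<noteq> 0"
          by (rule mon_term_mult_coeff_nonzeroE)
        show "p \<in> M0 \<and> xdeg n p \<le> d j \<and> gt0 0 p"
        proof (cases "b = 0")
          case True
          then show ?thesis using b aM a0 deg by simp
        next
          case False
          then have B: "b \<in> M0" "xdeg n b \<le> d i" "gt0 0 b"
            using UQ[of "d i"] b by (auto simp: adm_def)
          then have "gt0 a p" using gt0_add[of 0 b a] aM b by simp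
          then have "gt0 0 p" using gt0_trans[OF a0] aM B b by simp
          then show ?thesis using B b aM deg by simp
        qed
      qed
      note * = this
      show "psp_coeff u' 0 = 1"
        using *[of 0] gt0_irrefl[of 0] UQ[of "d j"] by (auto simp: u'_def adm_def)
      fix p assume p: "p \<noteq> 0 \<and> psp_coeff u' p \<noteq> 0"
      have "psp_coeff (U (d j)) p \<noteq> 0 \<or> psp_coeff (mon_term a c * U (d i)) p \<noteq> 0"
        using p by (auto simp: u'_def)
      then show "p \<in> M0" "xdeg n p \<le> d j" "gt0 0 p"
        using *[of p] p UQ[of "d j"] by (auto simp: adm_def)
    next
      fix i' p assume i': "i' < k" and "psp_coeff (q' i') p \<noteq> 0"
      then have "psp_coeff (Q (d j) i') p \<noteq> 0 \<or> psp_coeff (mon_term a c * Q (d i) i') p \<noteq> 0"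
        by (auto simp: q'_def)
      then show "ok (d j) i' p"
      proof
        assume "psp_coeff (Q (d j) i') p \<noteq> 0"
        then show ?thesis using UQ[of "d j"] i' by (auto simp: adm_def)
      next
        assume "psp_coeff (mon_term a c * Q (d i) i') p \<noteq> 0"
        then obtain b where b: "p = a + b" "psp_coeff (Q (d i) i') b \<noteq> 0"
          by (rule mon_term_mult_coeff_nonzeroE)
        then have B: "ok (d i) i' b" using UQ[of "d i"] i' by (auto simp: adm_def)
        have "gt0 b p" using gt0_add[OF a0, of b] B aM b by (simp add: ok_def add.commute)
        have "ge l (mon_act p w)" if w: "psv_coeff (gs ! i') w \<noteq> 0" for w
        proof -
          have wM: "w \<in> MM" using w g[OF i'] by (auto simp: Rxs_iff)
          have 1: "ge l (mon_act b w)" using B w by (auto simp: ok_def)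
          have "gt (mon_act b w) (mon_act p w)"
            using gt_act0[OF \<open>gt0 b p\<close>] B aM b wM by (auto simp: ok_def)
          then have 2: "ge (mon_act b w) (mon_act p w)" by (simp add: ge_def)
          show ?thesis by (rule ge_trans[OF 1 2 l(2)]) (use wM B aM b in \<open>simp_all add: ok_def\<close>)
        qed
        then show ?thesis using B b aM deg by (auto simp: ok_def)
      qed
    qed
    \<comment> \<open>Minimality of \<open>r (d j)\<close> contradicts the cancellation of its leading term.\<close>
    then obtain p where p: "psv_coeff (res u' q') p \<noteq> 0" "\<not> gt (t (d j)) p"
      using minr by blast
    have "res u' q' = r (d j) - mon_term a c \<odot> r (d i)"
      by (simp add: res_def r_def u'_def q'_def smult_vec_simps smult_vec_sum sum_subtractf)
    then have "gt (t (d j)) p"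
      using lm_mon_term_smult[OF aM c(1) r_Rxs t, of "d i"] tj c p aM
      by (intro cancel_leading[OF r_Rxs t, of "mon_term a c \<odot> r (d i)"])
        (auto intro!: Rxs_smult Rx_mon_term r_Rxs)
    then show ?thesis using p(2) by blast
  qed
qed

end

section \<open>Standard bases and divisibility of leading monomials\<close>

lemma expo_add_eq_0_iff: "a + b = 0 \<longleftrightarrow> a = 0 \<and> b = (0 :: expo)"
  by (metis Un_empty add_0 keys_add_expo keys_eq_empty)

lemma mon_add_eq_0_iff: "a + b = 0 \<longleftrightarrow> a = 0 \<and> b = (0 :: mon)"
  by (cases a; cases b) (auto simp: zero_prod_def expo_add_eq_0_iff)

lemma diff_in_Mon: "p \<in> Mon m n \<Longrightarrow> p - q \<in> Mon m n"
proof (cases p, cases q)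
  fix a b c d assume "p \<in> Mon m n" "p = (a, b)" "q = (c, d)"
  moreover have "keys (x - y) \<subseteq> keys x" for x y :: expo
    by (auto simp: in_keys_iff lookup_minus)
  ultimately show ?thesis by (auto simp: Mon_def Exp_def) blast+
qed

lemma mon_lcm_in_Mon: "p \<in> Mon m n \<Longrightarrow> q \<in> Mon m n \<Longrightarrow> mon_lcm p q \<in> Mon m n"
  by (simp add: mon_lcm_def diff_in_Mon)

lemma mon_lcm_diff_left: "(mon_lcm p q - p) + p = mon_lcm p q"
  by (cases p; cases q) (simp add: mon_lcm_def add.commute)

lemma mon_lcm_diff_right: "(mon_lcm p q - q) + q = mon_lcm p q"
proof -
  have "(a + (b - a) - b) + b = a + (b - a)" for a b :: expo
    by (rule poly_mapping_eqI) (simp add: lookup_add lookup_minus)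
  then show ?thesis by (cases p; cases q) (simp add: mon_lcm_def)
qed

text \<open>A common multiple \<open>a p = b q\<close> is a multiple of \<open>lcm p q\<close>; cancel \<open>p\<close>.\<close>

lemma mon_lcm_dvd:
  assumes "a + p = b + q"
  shows "\<exists>x. a = x + (mon_lcm p q - p)"
proof -
  have *: "a = (a - (q - p)) + (q - p)" if eq: "a + p = b + q" for a b p q :: expo
  proof (rule expo_decomp)
    fix k
    have "lookup a k + lookup p k = lookup b k + lookup q k"
      using eq by (metis lookup_add)
    then show "lookup (q - p) k \<le> lookup a k" by (simp add: lookup_minus)
  qed
  have "a = (a - (q - p)) + (q - p)"
    using assms *[of "fst a" "fst p" "fst b" "fst q"] *[of "snd a" "snd p" "snd b" "snd q"]
    by (auto simp: prod_eq_iff)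
  moreover have "mon_lcm p q - p = q - p" by (cases p; cases q) (simp add: mon_lcm_def)
  ultimately show ?thesis by metis
qed

lemma mon_act_assoc: "mon_act r (mon_act p w) = mon_act (r + p) w"
  by (cases w) (simp add: add.assoc)

lemma submodule_hull: "submodule_over A (submodule_over A hull B)"
  by (rule hull_in) (auto simp: submodule_over_def)

lemma submodule_zero: "submodule_over A N \<Longrightarrow> 0 \<in> N"
  and submodule_add: "submodule_over A N \<Longrightarrow> f \<in> N \<Longrightarrow> g \<in> N \<Longrightarrow> f + g \<in> N"
  and submodule_smult: "submodule_over A N \<Longrightarrow> a \<in> A \<Longrightarrow> f \<in> N \<Longrightarrow> a \<odot> f \<in> N"
  by (auto simp: submodule_over_def)

lemma submodule_sum: "submodule_over A N \<Longrightarrow> (\<And>i. i \<in> X \<Longrightarrow> f i \<in> N) \<Longrightarrow> sum f X \<in> N"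
  by (induction X rule: infinite_finite_induct) (auto simp: submodule_zero submodule_add)

lemma submodule_diff:
  assumes "submodule_over A N" "- 1 \<in> A" "f \<in> N" "g \<in> N"
  shows "f - g \<in> N"
proof -
  have "f - g = f + (- 1) \<odot> g" by (simp add: smult_vec_def fun_eq_iff)
  then show ?thesis using submodule_add[OF assms(1,3) submodule_smult[OF assms(1,2,4)]] by metis
qed

lemma mmon_vec_coeff: "psv_coeff (mmon_vec (Some w)) p = (if p = w then 1 else 0)"
  by (cases w; cases p) (auto simp: psv_coeff.simps)

context t_local_ordering
begin

lemma S_gt_Rx: "u \<in> S_gt m n gt0 \<Longrightarrow> u \<in> Rx m n"
  by (simp add: S_gt_def)

lemma S_gt_one [simp]: "1 \<in> S_gt m n gt0"
  by (auto simp: S_gt_iff)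

lemma S_gt_nonzero: "u \<in> S_gt m n gt0 \<Longrightarrow> u \<noteq> 0"
  by (auto simp: S_gt_iff)

lemma S_gt_mult:
  assumes u: "u \<in> S_gt m n gt0" and v: "v \<in> S_gt m n gt0"
  shows "u * v \<in> S_gt m n gt0"
proof -
  have "decomps 0 = {(0, 0)}"
    by (auto simp: decomps_def mon_add_eq_0_iff simp flip: zero_prod_def)
  then have "psp_coeff (u * v) 0 = 1"
    using u v by (simp add: psp_coeff_mult S_gt_iff)
  moreover have "p \<in> M0 \<and> gt0 0 p" if nz: "psp_coeff (u * v) p \<noteq> 0" "p \<noteq> 0" for p
  proof -
    obtain a b where "(a, b) \<in> decomps p" "psp_coeff u a * psp_coeff v b \<noteq> 0"
      using nz unfolding psp_coeff_mult by (auto elim: sum.not_neutral_contains_not_neutral)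
    then have "p = a + b" "psp_coeff u a \<noteq> 0" "psp_coeff v b \<noteq> 0"
      by (auto simp: decomps_def)
    then have ab: "p = a + b" "a = 0 \<or> a \<in> M0 \<and> gt0 0 a" "b = 0 \<or> b \<in> M0 \<and> gt0 0 b"
      using u v unfolding S_gt_iff by metis+
    then consider "p = a" "a \<in> M0" "gt0 0 a" | "p = b" "b \<in> M0" "gt0 0 b"
      | "a \<in> M0" "gt0 0 a" "b \<in> M0" "gt0 0 b" using nz(2) by fastforce
    then show ?thesis
    proof cases
      case 3
      then have "gt0 a p" using gt0_add[of 0 b a] ab(1) by simp
      then show ?thesis using gt0_trans[of 0 a p] 3 ab(1) by simp
    qed auto
  qed
  ultimately show ?thesis by (auto simp: S_gt_iff)
qed

lemma lm_product_dvd: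
  fixes g :: "'k::field psv"
  assumes "q \<in> Rx m n" "g \<in> Rxs m n s" "lm gt (q \<odot> g) = Some w"
  shows "lm_dvd (lm gt g) (Some w)"
proof -
  have "q \<odot> g \<noteq> 0" using assms(3) by (auto simp: lm_def)
  then have "q \<noteq> 0" "g \<noteq> 0" by (auto simp: smult_vec_simps)
  obtain p where p: "p \<in> M0" "psp_coeff q p \<noteq> 0" "\<And>b. psp_coeff q b \<noteq> 0 \<Longrightarrow> b \<noteq> p \<Longrightarrow> gt0 p b"
    using psp_top[OF assms(1) \<open>q \<noteq> 0\<close>] by blast
  obtain v where v: "lm gt g = Some v" using lm_exists[OF assms(2) \<open>g \<noteq> 0\<close>] by metis
  have "w = mon_act p v" using lm_smult(1)[OF assms(1) p(2,3) assms(2) v] assms(3) by simp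
  then show ?thesis using v by (auto simp: mmon_dvd_def)
qed

lemma mmon_dvd_MM:
  assumes "mmon_dvd v w" "w \<in> MM"
  obtains a where "a \<in> M0" "w = mon_act a v"
  using assms by (auto simp: mmon_dvd_def)

text \<open>
  The vectors all of whose monomials are divisible by some \<open>lm g\<close> form a \<open>K[t,x]\<close>-submodule that
  contains \<open>L G\<close>. Hence equality of the leading modules forces divisibility; conversely the
  generators of \<open>L I\<close> are monomial multiples of those of \<open>L G\<close>.
\<close>

lemma standard_basis_iff:
  fixes I :: "'k::field psv set"
  assumes I: "I \<subseteq> Rxs m n s" and G: "finite G" "G \<subseteq> I"
  shows "standard_basis m n gt G I \<longleftrightarrow> (\<forall>f\<in>I. f \<noteq> 0 \<longrightarrow> (\<exists>g\<in>G. lm_dvd (lm gt g) (lm gt f)))"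
proof
  assume "standard_basis m n gt G I"
  then have L: "L_gt m n gt G = L_gt m n gt I" by (simp add: standard_basis_def)
  define N :: "'k psv set" where "N = {v. \<forall>p. psv_coeff v p \<noteq> 0 \<longrightarrow> (\<exists>g\<in>G. lm_dvd (lm gt g) (Some p))}"
  have "L_gt m n gt G \<subseteq> N"
    unfolding L_gt_def
  proof (rule hull_minimal)
    show "(\<lambda>g. mmon_vec (lm gt g)) ` G \<subseteq> N"
    proof safe
      fix g assume "g \<in> G"
      have "\<exists>g\<in>G. lm_dvd (lm gt g) (Some p)" if nz: "psv_coeff (mmon_vec (lm gt g) :: 'k psv) p \<noteq> 0" for p
      proof (cases "lm gt g")
        case None
        then show ?thesis using nz by simp
      next
        case (Some w)
        then have "p = w" using nz by (auto simp: mmon_vec_coeff split: if_splits)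
        moreover have "mmon_dvd w w" unfolding mmon_dvd_def by (rule exI[of _ 0]) (cases w, simp)
        ultimately show ?thesis using Some \<open>g \<in> G\<close> by force
      qed
      then show "mmon_vec (lm gt g) \<in> N" by (simp add: N_def)
    qed
    have "\<exists>g\<in>G. lm_dvd (lm gt g) (Some (p, i))"
      if v: "v \<in> N" and nz: "psv_coeff (u \<odot> v) (p, i) \<noteq> 0" for u v p i
    proof -
      obtain a b where ab: "a + b = p" "psv_coeff v (b, i) \<noteq> 0"
        using nz by (rule smult_coeff_nonzeroE)
      then obtain g where g: "g \<in> G" "lm_dvd (lm gt g) (Some (b, i))" using v by (auto simp: N_def)
      then obtain w where w: "lm gt g = Some w" "mmon_dvd w (b, i)" by (cases "lm gt g") auto
      then obtain r where "(b, i) = mon_act r w" by (auto simp: mmon_dvd_def)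
      then have "(p, i) = mon_act (a + r) w"
        using ab(1) by (metis mon_act.simps mon_act_assoc)
      then have "mmon_dvd w (p, i)" by (auto simp: mmon_dvd_def)
      then show ?thesis using w g by force
    qed
    then show "submodule_over (Ktx m n) N"
      unfolding submodule_over_def N_def by (auto simp: split_paired_all) (metis add.right_neutral add_0)
  qed
  moreover have "mmon_vec (lm gt f) \<in> L_gt m n gt G" if "f \<in> I" for f
    using that unfolding L unfolding L_gt_def by (intro hull_inc) auto
  ultimately have mem: "mmon_vec (lm gt f) \<in> N" if "f \<in> I" for f using that by blast
  show "\<forall>f\<in>I. f \<noteq> 0 \<longrightarrow> (\<exists>g\<in>G. lm_dvd (lm gt g) (lm gt f))"
  proof (intro ballI impI)
    fix f assume f: "f \<in> I" "f \<noteq> 0"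
    then obtain w where w: "lm gt f = Some w" using lm_exists[of f] I by blast
    have "psv_coeff (mmon_vec (Some w) :: 'k psv) w \<noteq> 0" by (simp add: mmon_vec_coeff)
    then show "\<exists>g\<in>G. lm_dvd (lm gt g) (lm gt f)"
      using mem[OF f(1)] w unfolding N_def by auto
  qed
next
  assume dvd: "\<forall>f\<in>I. f \<noteq> 0 \<longrightarrow> (\<exists>g\<in>G. lm_dvd (lm gt g) (lm gt f))"
  have sub: "submodule_over (Ktx m n) (L_gt m n gt G)"
    unfolding L_gt_def by (rule submodule_hull)
  have "L_gt m n gt I \<subseteq> L_gt m n gt G"
    unfolding L_gt_def[of m n gt I]
  proof (rule hull_minimal, rule image_subsetI)
    fix f assume f: "f \<in> I"
    show "mmon_vec (lm gt f) \<in> L_gt m n gt G"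
    proof (cases "f = 0")
      case True
      then show ?thesis using submodule_zero[OF sub] by (simp add: lm_def)
    next
      case False
      then obtain w where w: "lm gt f = Some w" "w \<in> MM" using lm_exists[of f] I f by blast
      obtain g where g: "g \<in> G" "lm_dvd (lm gt g) (Some w)" using dvd f False w by metis
      then obtain v where v: "lm gt g = Some v" "mmon_dvd v w" by (cases "lm gt g") auto
      obtain a where a: "a \<in> M0" "w = mon_act a v" using mmon_dvd_MM[OF v(2) w(2)] by blast
      have "mon_term a (1::'k) \<in> Ktx m n"
        using Rx_mon_term[OF a(1), of "1::'k"] by (cases a) (auto simp: Ktx_def lookup_single when_def)
      moreover have "mmon_vec (lm gt g) \<in> L_gt m n gt G"
        unfolding L_gt_def using g(1) by (intro hull_inc) auto
      ultimately have "mon_term a (1::'k) \<odot> mmon_vec (lm gt g) \<in> L_gt m n gt G"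
        by (rule submodule_smult[OF sub])
      moreover have "mon_term a (1::'k) \<odot> mmon_vec (lm gt g) = mmon_vec (lm gt f)"
      proof -
        have "mon_term a (1::'k) * mon_term b 1 = mon_term (a + b) 1" for b
        proof -
          have "psp_coeff (mon_term a (1::'k) * mon_term b 1) p = psp_coeff (mon_term (a + b) 1) p" for p
          proof -
            have "psp_coeff (mon_term a (1::'k) * mon_term b 1) p
              = (\<Sum>x\<in>decomps p. if x = (a, b) then 1 else 0)"
              unfolding psp_coeff_mult
            proof (rule sum.cong[OF refl])
              fix x :: "mon \<times> mon"
              obtain c d where "x = (c, d)" by (cases x)
              then show "(case x of (c, d) \<Rightarrow> psp_coeff (mon_term a (1::'k)) c * psp_coeff (mon_term b 1) d)
                  = (if x = (a, b) then 1 else 0)"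
                by simp
            qed
            also have "\<dots> = psp_coeff (mon_term (a + b) 1) p"
              by (simp add: sum.delta) (auto simp: decomps_def)
            finally show ?thesis .
          qed
          then show ?thesis by (simp add: psp_eq_iff)
        qed
        then show ?thesis
          unfolding w(1) v(1) a(2) by (cases v) (auto simp: smult_vec_def fun_eq_iff)
      qed
      ultimately show ?thesis by simp
    qed
  qed (rule sub)
  moreover have "L_gt m n gt G \<subseteq> L_gt m n gt I"
    unfolding L_gt_def using G(2) by (intro hull_mono image_mono)
  ultimately show "standard_basis m n gt G I"
    using G by (auto simp: standard_basis_def)
qed

text \<open>Multiplication by \<open>u \<in> S\<close> preserves \<open>lm f\<close>, which must therefore occur in some \<open>q\<^sub>i g\<^sub>i\<close>; being an
  upper bound for the terms of this product it is its leading monomial.\<close>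

lemma weak_standard_rep_lm_dvd:
  fixes f :: "'k::field psv"
  assumes f: "f \<in> Rxs m n s" "f \<noteq> 0" and gs: "set gs \<subseteq> Rxs m n s"
    and rep: "has_weak_standard_rep m n s gt gt0 gs f"
  shows "\<exists>g\<in>set gs. lm_dvd (lm gt g) (lm gt f)"
proof -
  obtain w where w: "lm gt f = Some w" using lm_exists[OF f] by blast
  note W = lm_SomeD[OF f(1) w]
  obtain u q where u: "u \<in> S_gt m n gt0" and q: "\<And>i. i < length gs \<Longrightarrow> q i \<in> Rx m n"
    and eq: "u \<odot> f = (\<Sum>i<length gs. q i \<odot> gs ! i)"
    and le: "\<And>i. i < length gs \<Longrightarrow> lm_le gt (lm gt (q i \<odot> gs ! i)) (lm gt f)"
    using rep by (auto simp: has_weak_standard_rep_def weak_division_def)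
  have "lm gt (u \<odot> f) = Some w" using lm_S_smult[OF u f(1)] w by simp
  then have "psv_coeff (u \<odot> f) w \<noteq> 0"
    using lm_SomeD(3)[OF Rxs_smult[OF S_gt_Rx[OF u] f(1)]] by blast
  then obtain i where i: "i < length gs" "psv_coeff (q i \<odot> gs ! i) w \<noteq> 0"
    unfolding eq psv_coeff_sum by (auto elim: sum.not_neutral_contains_not_neutral)
  have gi: "gs ! i \<in> Rxs m n s" using gs i by auto
  have "lm gt (q i \<odot> gs ! i) = Some w"
    using le[OF i(1)] unfolding w lm_le_iff[OF Rxs_smult[OF q[OF i(1)] gi] W(2)]
    by (intro lm_eqI Rxs_smult q i gi) blast+
  then have "lm_dvd (lm gt (gs ! i)) (lm gt f)"
    using lm_product_dvd[OF q[OF i(1)] gi] w by simp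
  then show ?thesis using i(1) by auto
qed

lemma spoly_in_submodule:
  fixes I :: "'k::field psv set"
  assumes I: "I \<subseteq> Rxs m n s" "submodule_over (Rx m n) I" and f: "f \<in> I" and g: "g \<in> I"
  shows "spoly gt f g \<in> I"
proof (cases "f = 0 \<or> g = 0")
  case True
  then have "spoly gt f g = 0" by (auto simp: spoly_def lm_def)
  then show ?thesis using submodule_zero[OF I(2)] by simp
next
  case False
  have fg: "f \<in> Rxs m n s" "g \<in> Rxs m n s" using f g I by auto
  have "lm gt f \<noteq> None" "lm gt g \<noteq> None" using False by (simp_all add: lm_None_iff)
  then obtain p i q j where p: "lm gt f = Some (p, i)" and q: "lm gt g = Some (q, j)"
    by (metis option.exhaust surj_pair)
  have "p \<in> M0" "q \<in> M0" using lm_SomeD(2)[OF fg(1) p] lm_SomeD(2)[OF fg(2) q] by auto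
  then have "mon_term (mon_lcm p q - p) c \<in> Rx m n" "mon_term (mon_lcm p q - q) c \<in> Rx m n" for c :: 'k
    by (auto intro!: Rx_mon_term diff_in_Mon mon_lcm_in_Mon)
  then show ?thesis
    using p q f g submodule_zero[OF I(2)]
    by (auto simp: spoly_def intro!: submodule_diff[OF I(2)] submodule_smult[OF I(2)] Rx_uminus)
qed

end

section \<open>Localisation\<close>

lemma sum_Fract_same_denominator:
  "u \<noteq> 0 \<Longrightarrow> (\<Sum>a\<in>A. Fract (h a) u) = Fract (\<Sum>a\<in>A. h a) u"
proof (induction A rule: infinite_finite_induct)
  case (insert a A)
  then show ?case by (simp add: eq_fract algebra_simps)
qed (simp_all add: Zero_fract_def eq_fract)

context t_local_ordering
begin

lemma loc_span_memI:
  fixes f :: "'k::field psv"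
  assumes u: "u \<in> S_gt m n gt0" and q: "\<And>i. i < length gs \<Longrightarrow> q i \<in> Rx m n"
    and eq: "u \<odot> f = (\<Sum>i<length gs. q i \<odot> gs ! i)"
  shows "fract_vec f \<in> loc_span m n gt0 (set gs)"
proof -
  let ?N = "loc_span m n gt0 (set gs)"
  have sub: "submodule_over (Rx_loc m n gt0) ?N"
    unfolding loc_span_def by (rule submodule_hull)
  have "fract_vec f = (\<Sum>i<length gs. Fract (q i) u \<odot> fract_vec (gs ! i))"
  proof
    fix j
    have "u * f j = (\<Sum>i<length gs. q i * (gs ! i) j)"
      using fun_cong[OF eq, of j] by (simp add: smult_vec_def sum_fun_apply)
    then have "fract_vec f j = Fract (\<Sum>i<length gs. q i * (gs ! i) j) u"
      using S_gt_nonzero[OF u] by (simp add: fract_vec_def eq_fract mult.commute)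
    also have "\<dots> = (\<Sum>i<length gs. Fract (q i * (gs ! i) j) u)"
      using S_gt_nonzero[OF u] by (simp add: sum_Fract_same_denominator)
    finally show "fract_vec f j = (\<Sum>i<length gs. Fract (q i) u \<odot> fract_vec (gs ! i)) j"
      by (simp add: smult_vec_def sum_fun_apply fract_vec_def)
  qed
  moreover have "Fract (q i) u \<odot> fract_vec (gs ! i) \<in> ?N" if "i < length gs" for i
  proof (rule submodule_smult[OF sub])
    show "Fract (q i) u \<in> Rx_loc m n gt0" using q[OF that] u by (auto simp: Rx_loc_def)
    show "fract_vec (gs ! i) \<in> ?N" unfolding loc_span_def using that by (intro hull_inc) auto
  qed
  ultimately show ?thesis by (auto intro: submodule_sum[OF sub])
qed

text \<open>Clearing denominators: the vectors \<open>(\<Sum> q\<^sub>i g\<^sub>i) / u\<close> with a common denominator \<open>u \<in> S\<close> already form a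
  submodule over the localisation.\<close>

lemma loc_span_memD:
  fixes f :: "'k::field psv"
  assumes "fract_vec f \<in> loc_span m n gt0 (set gs)"
  shows "\<exists>u q. u \<in> S_gt m n gt0 \<and> (\<forall>i<length gs. q i \<in> Rx m n) \<and> u \<odot> f = (\<Sum>i<length gs. q i \<odot> gs ! i)"
proof -
  let ?k = "length gs"
  define cmb where "cmb q = (\<Sum>i<?k. q i \<odot> gs ! i)" for q :: "nat \<Rightarrow> 'k psp"
  have cmb_add: "cmb (\<lambda>i. q i + q' i) = cmb q + cmb q'" for q q'
    by (simp add: cmb_def smult_vec_simps sum.distrib)
  have cmb_smult: "cmb (\<lambda>i. u * q i) = u \<odot> cmb q" for u q
    by (simp add: cmb_def smult_vec_simps smult_vec_sum)
  define W where "W = {v. \<exists>u q. u \<in> S_gt m n gt0 \<and> (\<forall>i<?k. q i \<in> Rx m n) \<and> v = (\<lambda>j. Fract (cmb q j) u)}"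
  have WI: "v \<in> W" if "u \<in> S_gt m n gt0" "\<And>i. i < ?k \<Longrightarrow> q i \<in> Rx m n" "\<And>j. v j = Fract (cmb q j) u" for v u q
    using that unfolding W_def by (auto intro!: exI[of _ u] exI[of _ q])
  have "loc_span m n gt0 (set gs) \<subseteq> W"
    unfolding loc_span_def
  proof (rule hull_minimal)
    show "fract_vec ` set gs \<subseteq> W"
    proof (rule image_subsetI)
      fix g assume "g \<in> set gs"
      then obtain i where i: "i < ?k" "g = gs ! i" by (auto simp: in_set_conv_nth)
      have "cmb (\<lambda>l. if l = i then 1 else 0) = (\<Sum>l<?k. if l = i then gs ! l else 0)"
        unfolding cmb_def by (intro sum.cong refl) (simp add: smult_vec_simps)
      then have "cmb (\<lambda>l. if l = i then 1 else 0) = g" using i by simp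
      then show "fract_vec g \<in> W"
        by (intro WI[of 1 "\<lambda>l. if l = i then 1 else 0"]) (auto simp: fract_vec_def)
    qed
    show "submodule_over (Rx_loc m n gt0) W"
      unfolding submodule_over_def
    proof (intro conjI ballI)
      have "cmb (\<lambda>_. 0) = 0" by (simp add: cmb_def smult_vec_simps)
      then show "0 \<in> W" by (intro WI[of 1 "\<lambda>_. 0"]) (auto simp: Zero_fract_def)
    next
      fix v w assume "v \<in> W" "w \<in> W"
      then obtain u q u' q' where v: "u \<in> S_gt m n gt0" "\<And>i. i < ?k \<Longrightarrow> q i \<in> Rx m n" "v = (\<lambda>j. Fract (cmb q j) u)"
        and w: "u' \<in> S_gt m n gt0" "\<And>i. i < ?k \<Longrightarrow> q' i \<in> Rx m n" "w = (\<lambda>j. Fract (cmb q' j) u')"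
        by (auto simp: W_def)
      show "v + w \<in> W"
      proof (rule WI)
        show "u * u' \<in> S_gt m n gt0" using v w by (intro S_gt_mult)
        show "u' * q i + u * q' i \<in> Rx m n" if "i < ?k" for i
          using that v(2) w(2) S_gt_Rx[OF v(1)] S_gt_Rx[OF w(1)] by (intro Rx_add Rx_mult)
        show "(v + w) j = Fract (cmb (\<lambda>i. u' * q i + u * q' i) j) (u * u')" for j
          using S_gt_nonzero[OF v(1)] S_gt_nonzero[OF w(1)]
          by (simp add: v(3) w(3) cmb_add cmb_smult smult_vec_def mult.commute)
      qed
    next
      fix x :: "'k psp fract" and v
      assume "x \<in> Rx_loc m n gt0" "v \<in> W"
      then obtain h u' u q where x: "x = Fract h u'" "h \<in> Rx m n" "u' \<in> S_gt m n gt0"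
        and v: "u \<in> S_gt m n gt0" "\<And>i. i < ?k \<Longrightarrow> q i \<in> Rx m n" "v = (\<lambda>j. Fract (cmb q j) u)"
        by (auto simp: W_def Rx_loc_def)
      show "x \<odot> v \<in> W"
      proof (rule WI)
        show "u' * u \<in> S_gt m n gt0" using v x by (intro S_gt_mult)
        show "h * q i \<in> Rx m n" if "i < ?k" for i using that v x by (intro Rx_mult)
        show "(x \<odot> v) j = Fract (cmb (\<lambda>i. h * q i) j) (u' * u)" for j
          by (simp add: v(3) x(1) cmb_smult smult_vec_def)
      qed
    qed
  qed
  then have "fract_vec f \<in> W" using assms by blast
  then obtain u q where uq: "u \<in> S_gt m n gt0" "\<forall>i<?k. q i \<in> Rx m n" "fract_vec f = (\<lambda>j. Fract (cmb q j) u)"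
    by (auto simp: W_def)
  have "u * f j = cmb q j" for j
    using fun_cong[OF uq(3), of j] S_gt_nonzero[OF uq(1)] by (simp add: fract_vec_def eq_fract mult.commute)
  then have "u \<odot> f = cmb q" by (simp add: smult_vec_def fun_eq_iff)
  then show ?thesis using uq unfolding cmb_def by blast
qed

end

section \<open>Buchberger's criterion\<close>

definition lincomb :: "'a::comm_ring_1 psv list \<Rightarrow> 'a psv \<Rightarrow> 'a psv"
  where "lincomb gs h = (\<Sum>i<length gs. h i \<odot> gs ! i)"

lemma lincomb_simps:
  "lincomb gs 0 = 0"
  "lincomb gs (a + b) = lincomb gs a + lincomb gs b"
  "lincomb gs (a - b) = lincomb gs a - lincomb gs b"
  "lincomb gs (c \<odot> a) = c \<odot> lincomb gs a"
  by (simp_all add: lincomb_def smult_vec_simps sum.distrib sum_subtractf smult_vec_sum)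
    (simp add: smult_vec_def mult.assoc)

lemma lincomb_sum: "lincomb gs (sum a A) = (\<Sum>x\<in>A. lincomb gs (a x))"
  by (induction A rule: infinite_finite_induct)
    (simp_all only: lincomb_simps sum.insert sum.infinite sum.empty not_False_eq_True)

context t_local_ordering
begin

lemma has_weak_standard_rep_zero: "has_weak_standard_rep m n s gt gt0 gs (0 :: 'k::field psv)"
  unfolding has_weak_standard_rep_def weak_division_def
  by (intro exI[of _ 1] exI[of _ "\<lambda>_. 0"]) (simp add: smult_vec_simps lm_def)

text \<open>Schreyer's ordering, with \<open>wt i\<close> in the role of \<open>lm g\<^sub>i\<close>. Among terms producing the same monomial the
  one with the smaller index is the larger.\<close>

definition schreyer_gt :: "(nat \<Rightarrow> mmon) \<Rightarrow> mmon \<Rightarrow> mmon \<Rightarrow> bool"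
  where "schreyer_gt wt P Q \<longleftrightarrow>
    gt (mon_act (fst P) (wt (snd P))) (mon_act (fst Q) (wt (snd Q))) \<or>
    mon_act (fst P) (wt (snd P)) = mon_act (fst Q) (wt (snd Q)) \<and> snd P < snd Q"

lemma schreyer_ordering:
  assumes wt: "\<And>i. i < k \<Longrightarrow> wt i \<in> MM"
  shows "t_local_ordering m n k (schreyer_gt wt) gt0"
proof -
  let ?gtS = "schreyer_gt wt"
  have wM: "mon_act (fst P) (wt (snd P)) \<in> MM" if "P \<in> MMon m n k" for P
    using that wt by (cases P) auto
  show ?thesis
  proof
    have ind: "gt0 p q \<longleftrightarrow> ?gtS (p, i) (q, i)" if "i < k" "p \<in> M0" "q \<in> M0" for i p q
    proof -
      have "?gtS (p, i) (q, i) \<longleftrightarrow> gt (mon_act p (wt i)) (mon_act q (wt i))" by (simp add: schreyer_gt_def)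
      moreover have "gt (mon_act p (wt i)) (mon_act q (wt i))" if "gt0 p q"
        using gt_act0[OF that] \<open>p \<in> M0\<close> \<open>q \<in> M0\<close> wt[OF \<open>i < k\<close>] by blast
      moreover have "\<not> gt (mon_act p (wt i)) (mon_act q (wt i))" if "\<not> gt0 p q"
      proof
        assume gt: "gt (mon_act p (wt i)) (mon_act q (wt i))"
        have M: "mon_act p (wt i) \<in> MM" "mon_act q (wt i) \<in> MM" using \<open>p \<in> M0\<close> \<open>q \<in> M0\<close> wt[OF \<open>i < k\<close>] by auto
        from that have "p = q \<or> gt0 q p" using gt0_total \<open>p \<in> M0\<close> \<open>q \<in> M0\<close> by blast
        then show False
          using gt gt_irrefl[OF M(1)] gt_trans[OF gt _ M(1) M(2) M(1)] gt_act0[of q p "wt i"]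
            \<open>p \<in> M0\<close> \<open>q \<in> M0\<close> wt[OF \<open>i < k\<close>] by blast
      qed
      ultimately show ?thesis by blast
    qed
    then show "induced_ordering m n k ?gtS gt0"
      using gt0_induced by (auto simp: induced_ordering_def)
    have "strict_total_on (MMon m n k) ?gtS"
      unfolding strict_total_on_def
    proof (intro conjI)
      show "irreflp_on (MMon m n k) ?gtS"
        unfolding irreflp_on_def schreyer_gt_def using gt_irrefl wM by blast
      show "transp_on (MMon m n k) ?gtS"
        unfolding transp_on_def
      proof (intro ballI impI)
        fix P Q R assume "P \<in> MMon m n k" "Q \<in> MMon m n k" "R \<in> MMon m n k"
        note M = this[THEN wM]
        assume "?gtS P Q" "?gtS Q R"
        then show "?gtS P R"
          using gt_trans[OF _ _ M] unfolding schreyer_gt_def by auto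
      qed
      show "totalp_on (MMon m n k) ?gtS"
        unfolding totalp_on_def
      proof (intro ballI impI)
        fix P Q assume PQ: "P \<in> MMon m n k" "Q \<in> MMon m n k" "P \<noteq> Q"
        show "?gtS P Q \<or> ?gtS Q P"
        proof (cases "mon_act (fst P) (wt (snd P)) = mon_act (fst Q) (wt (snd Q))")
          case True
          have "snd P \<noteq> snd Q"
          proof
            assume e: "snd P = snd Q"
            then have "fst P = fst Q" using True by (cases "wt (snd Q)") simp
            then show False using e PQ(3) by (simp add: prod_eq_iff)
          qed
          then show ?thesis using True by (auto simp: schreyer_gt_def)
        next
          case False
          then show ?thesis using gt_total[OF wM[OF PQ(1)] wM[OF PQ(2)]] by (auto simp: schreyer_gt_def)
        qed
      qed
    qed
    moreover have "?gtS (mon_act r P) (mon_act r Q)"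
      if PQ: "P \<in> MMon m n k" "Q \<in> MMon m n k" "r \<in> M0" "?gtS P Q" for P Q r
    proof -
      have e: "mon_act (fst (mon_act r P)) (wt (snd (mon_act r P))) = mon_act r (mon_act (fst P) (wt (snd P)))" for P
        by (cases P) (simp add: mon_act_assoc)
      have e2: "snd (mon_act r P) = snd P" for P by (cases P) simp
      show ?thesis
        using that(4) gt_act[OF _ wM[OF PQ(1)] wM[OF PQ(2)] PQ(3)] unfolding schreyer_gt_def e unfolding e2 by auto
    qed
    ultimately show "module_monomial_ordering m n k ?gtS"
      using \<open>induced_ordering m n k ?gtS gt0\<close> by (auto simp: module_monomial_ordering_def)
    show "t_local m gt0" by (rule gt0_local)
  qed
qed

text \<open>
  Let \<open>us \<cdot> spoly = \<Sum> qs\<^sub>l g\<^sub>l\<close> be a weak standard representation. The syzygy is \<open>us \<cdot> \<tau> - \<rho>\<close>,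
  where \<open>\<tau>\<close> has the two terms that form the S-polynomial and \<open>\<rho>\<close> the entries \<open>qs\<^sub>l\<close>. Both terms of
  \<open>\<tau>\<close> produce the monomial \<open>lcm\<close>, and the tie is decided in favour of \<open>i < j\<close>. The terms of \<open>\<rho>\<close> produce monomials at most \<open>lm spoly\<close>, which is smaller than
  the \<open>lcm\<close> because the leading terms cancel.
\<close>

lemma spoly_syzygy:
  fixes gs :: "'k::field psv list"
  assumes gs: "set gs \<subseteq> Rxs m n s"
    and wt: "\<And>l. l < length gs \<Longrightarrow> wt l \<in> MM"
    and lm_wt: "\<And>l. gs ! l \<noteq> 0 \<Longrightarrow> lm gt (gs ! l) = Some (wt l)"
    and ij: "i < j" "j < length gs" and nz: "gs ! i \<noteq> 0" "gs ! j \<noteq> 0"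
    and p: "wt i = (p, c)" and q: "wt j = (q, c)"
    and spoly: "has_weak_standard_rep m n s gt gt0 gs (spoly gt (gs ! i) (gs ! j))"
  shows "\<exists>\<sigma>\<in>Rxs m n (length gs). lincomb gs \<sigma> = 0 \<and>
    lm (schreyer_gt wt) \<sigma> = Some (mon_lcm p q - p, i)"
proof -
  let ?gtS = "schreyer_gt wt"
  define k where "k = length gs"
  note wt = wt[folded k_def] and ij = ij[folded k_def]
  have lin: "lincomb gs h = (\<Sum>l<k. h l \<odot> gs ! l)" for h
    by (simp add: lincomb_def k_def)
  have g: "gs ! l \<in> Rxs m n s" if "l < k" for l using gs that by (auto simp: k_def)
  interpret S: t_local_ordering m n k ?gtS gt0
    by (rule schreyer_ordering) (rule wt)
  have "i < k" using ij by simp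
  have pq: "p \<in> M0" "q \<in> M0" "c < s" using wt[OF \<open>i < k\<close>] wt[OF ij(2)] p q by auto
  define m1 where "m1 = mon_lcm p q - p"
  define m2 where "m2 = mon_lcm p q - q"
  have mM: "m1 \<in> M0" "m2 \<in> M0" using pq by (auto simp: m1_def m2_def intro!: diff_in_Mon mon_lcm_in_Mon)
  have act: "mon_act m1 (wt i) = (mon_lcm p q, c)" "mon_act m2 (wt j) = (mon_lcm p q, c)"
    using p q by (simp_all add: m1_def m2_def mon_lcm_diff_left mon_lcm_diff_right)
  define a where "a = 1 / psv_coeff (gs ! i) (wt i)"
  define b where "b = 1 / psv_coeff (gs ! j) (wt j)"
  have ab: "a \<noteq> 0" "b \<noteq> 0" "a * psv_coeff (gs ! i) (wt i) = 1" "b * psv_coeff (gs ! j) (wt j) = 1"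
    using lm_SomeD(3)[OF g[OF \<open>i < k\<close>] lm_wt[OF nz(1)]] lm_SomeD(3)[OF g[OF ij(2)] lm_wt[OF nz(2)]]
    by (auto simp: a_def b_def)
  define sp where "sp = spoly gt (gs ! i) (gs ! j)"
  have sp: "sp = mon_term m1 a \<odot> gs ! i - mon_term m2 b \<odot> gs ! j"
    unfolding sp_def spoly_def lm_wt[OF nz(1)] lm_wt[OF nz(2)] by (simp add: p q m1_def m2_def a_def b_def)
  have spR: "sp \<in> Rxs m n s"
    unfolding sp using mM ij g by (intro Rxs_diff Rxs_smult Rx_mon_term) auto
  have sp_less: "gt (mon_lcm p q, c) e" if "psv_coeff sp e \<noteq> 0" for e
  proof (rule cancel_leading)
    show "lm gt (mon_term m1 a \<odot> gs ! i) = Some (mon_lcm p q, c)"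
      using lm_mon_term_smult(1)[OF mM(1) ab(1) g[OF \<open>i < k\<close>] lm_wt[OF nz(1)]] act by simp
    show "lm gt (mon_term m2 b \<odot> gs ! j) = Some (mon_lcm p q, c)"
      using lm_mon_term_smult(1)[OF mM(2) ab(2) g[OF ij(2)] lm_wt[OF nz(2)]] act by simp
    show "psv_coeff (mon_term m1 a \<odot> gs ! i) (mon_lcm p q, c) = psv_coeff (mon_term m2 b \<odot> gs ! j) (mon_lcm p q, c)"
      using lm_mon_term_smult(2)[OF mM(1) ab(1) g[OF \<open>i < k\<close>] lm_wt[OF nz(1)]]
        lm_mon_term_smult(2)[OF mM(2) ab(2) g[OF ij(2)] lm_wt[OF nz(2)]] act ab by simp
    show "psv_coeff (mon_term m1 a \<odot> gs ! i - mon_term m2 b \<odot> gs ! j) e \<noteq> 0"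
      using that unfolding sp .
  qed (use mM ij g in \<open>auto intro!: Rxs_smult Rx_mon_term\<close>)
  obtain us qs where us: "us \<in> S_gt m n gt0" and qs: "\<And>l. l < k \<Longrightarrow> qs l \<in> Rx m n"
    and sp_eq: "us \<odot> sp = (\<Sum>l<k. qs l \<odot> gs ! l)"
    and sp_le: "\<And>l. l < k \<Longrightarrow> lm_le gt (lm gt (qs l \<odot> gs ! l)) (lm gt sp)"
    using spoly
    unfolding has_weak_standard_rep_def weak_division_def sp_def[symmetric] k_def[symmetric] by auto
  define \<tau> where "\<tau> l = (if l = i then mon_term m1 a else if l = j then - mon_term m2 b else 0)" for l
  \<comment> \<open>Entries at zero generators are dropped: nothing bounds their monomials.\<close>
  define \<rho> where "\<rho> l = (if l < k \<and> gs ! l \<noteq> 0 then qs l else 0)" for l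
  have \<tau>R: "\<tau> \<in> Rxs m n k" and \<rho>R: "\<rho> \<in> Rxs m n k"
    using ij mM qs by (auto simp: Rxs_def \<tau>_def \<rho>_def intro!: Rx_mon_term Rx_uminus)
  have "lincomb gs \<tau> = (\<Sum>l<k. (if l = i then mon_term m1 a \<odot> gs ! l else 0) - (if l = j then mon_term m2 b \<odot> gs ! l else 0))"
    unfolding lin \<tau>_def using ij by (intro sum.cong refl) (auto simp: smult_vec_simps)
  also have "\<dots> = sp" using ij unfolding sp by (simp add: sum_subtractf)
  finally have lin_\<tau>: "lincomb gs \<tau> = sp" .
  have lin_\<rho>: "lincomb gs \<rho> = us \<odot> sp"
    unfolding lin sp_eq \<rho>_def by (intro sum.cong refl) (auto simp: smult_vec_simps)
  have \<tau>_coeff: "psv_coeff \<tau> e = (if e = (m1, i) then a else if e = (m2, j) then - b else 0)" for e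
    using ij by (cases e) (auto simp: psv_coeff.simps \<tau>_def)
  have ge_mj: "?gtS (m1, i) (m2, j)" using act ij by (simp add: schreyer_gt_def)
  have "lm ?gtS \<tau> = Some (m1, i)"
    using ge_mj ab by (intro S.lm_eqI \<tau>R) (auto simp: \<tau>_coeff S.ge_def split: if_splits)
  then have lm\<tau>: "lm ?gtS (us \<odot> \<tau>) = Some (m1, i)"
    using S.lm_S_smult[OF us \<tau>R] by simp
  have us\<tau>R: "us \<odot> \<tau> \<in> Rxs m n k" using S_gt_Rx[OF us] \<tau>R by (rule Rxs_smult)
  note T = S.lm_SomeD[OF us\<tau>R lm\<tau>]
  have \<rho>_less: "?gtS (m1, i) (x, l)" if x: "psv_coeff \<rho> (x, l) \<noteq> 0" for x l
  proof -
    from x have l: "l < k" "gs ! l \<noteq> 0" "psp_coeff (qs l) x \<noteq> 0"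
      by (auto simp: psv_coeff.simps \<rho>_def split: if_splits)
    then have "qs l \<noteq> 0" by auto
    then obtain t where t: "t \<in> M0" "psp_coeff (qs l) t \<noteq> 0"
        "\<And>y. psp_coeff (qs l) y \<noteq> 0 \<Longrightarrow> y \<noteq> t \<Longrightarrow> gt0 t y"
      using psp_top[OF qs[OF l(1)]] by blast
    have xM: "x \<in> M0" using qs[OF l(1)] l(3) by (auto simp: Rx_iff)
    have M: "mon_act t (wt l) \<in> MM" "mon_act x (wt l) \<in> MM" "(mon_lcm p q, c) \<in> MM"
      using t xM wt[OF l(1)] pq by (auto intro: mon_lcm_in_Mon)
    have lmq: "lm gt (qs l \<odot> gs ! l) = Some (mon_act t (wt l))"
      by (rule lm_smult(1)[OF qs[OF l(1)] t(2,3) g[OF l(1)] lm_wt[OF l(2)]])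
    then obtain e where e: "lm gt sp = Some e" "ge e (mon_act t (wt l))"
      using sp_le[OF l(1)] by (cases "lm gt sp") (auto simp: ge_def)
    note E = lm_SomeD[OF spR e(1)]
    have "gt (mon_lcm p q, c) (mon_act t (wt l))"
      by (rule gt_ge_trans[OF sp_less[OF E(3)] e(2) M(3) E(2) M(1)])
    moreover have "ge (mon_act t (wt l)) (mon_act x (wt l))"
      using t(3)[OF l(3)] gt_act0[OF _ t(1) xM wt[OF l(1)]] by (auto simp: ge_def)
    ultimately have "gt (mon_lcm p q, c) (mon_act x (wt l))"
      using gt_ge_trans M by blast
    then show ?thesis using act by (simp add: schreyer_gt_def)
  qed
  define \<sigma> where "\<sigma> = us \<odot> \<tau> - \<rho>"
  have \<sigma>R: "\<sigma> \<in> Rxs m n k" unfolding \<sigma>_def using us\<tau>R \<rho>R by (rule Rxs_diff)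
  have "psv_coeff \<rho> (m1, i) = 0"
    using \<rho>_less[of m1 i] S.gt_irrefl[of "(m1, i)"] mM \<open>i < k\<close> by auto
  then have "lm ?gtS \<sigma> = Some (m1, i)"
  proof (intro S.lm_eqI \<sigma>R)
    show "psv_coeff \<sigma> (m1, i) \<noteq> 0" using T(3) \<open>psv_coeff \<rho> (m1, i) = 0\<close> by (simp add: \<sigma>_def)
    fix e assume "psv_coeff \<sigma> e \<noteq> 0"
    then have "psv_coeff (us \<odot> \<tau>) e \<noteq> 0 \<or> psv_coeff \<rho> e \<noteq> 0" by (auto simp: \<sigma>_def)
    then show "S.ge (m1, i) e"
    proof
      assume "psv_coeff \<rho> e \<noteq> 0"
      then show ?thesis using \<rho>_less[of "fst e" "snd e"] by (simp add: S.ge_def)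
    qed (rule T(4))
  qed
  moreover have "lincomb gs \<sigma> = 0" unfolding \<sigma>_def lincomb_simps lin_\<tau> lin_\<rho> by simp
  ultimately show ?thesis using \<sigma>R unfolding m1_def k_def by blast
qed

text \<open>
  The coefficient vector of a given representation of \<open>u f\<close> is divided, with respect to Schreyer's
  ordering, by the syzygies coming from the S-polynomials and by the unit vectors \<open>e\<^sub>i\<close> with
  \<open>g\<^sub>i = 0\<close>. All of these combine to zero, so the remainder represents \<open>f\<close> again, and it is a weak
  standard representation.
\<close>

lemma buchberger_criterion:
  fixes f :: "'k::field psv"
  assumes gs: "set gs \<subseteq> Rxs m n s"
    and spoly: "\<And>i j. i < j \<Longrightarrow> j < length gs \<Longrightarrow> has_weak_standard_rep m n s gt gt0 gs (spoly gt (gs ! i) (gs ! j))"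
    and f: "f \<in> Rxs m n s"
    and u: "u \<in> S_gt m n gt0" and q: "\<And>i. i < length gs \<Longrightarrow> q i \<in> Rx m n"
    and eq: "u \<odot> f = (\<Sum>i<length gs. q i \<odot> gs ! i)"
  shows "has_weak_standard_rep m n s gt gt0 gs f"
proof (cases "f = 0")
  case True
  then show ?thesis using has_weak_standard_rep_zero by simp
next
  case False
  define k where "k = length gs"
  obtain w\<^sub>0 where "w\<^sub>0 \<in> MM" using lm_exists[OF f False] by blast
  then have s: "s > 0" by (cases w\<^sub>0) auto
  have g: "gs ! i \<in> Rxs m n s" if "i < k" for i using gs that by (auto simp: k_def)
  \<comment> \<open>A zero generator gets an arbitrary monomial of the module as weight; this needs \<open>s > 0\<close>.\<close>
  define wt where "wt i = (case lm gt (gs ! i) of Some w \<Rightarrow> w | None \<Rightarrow> (0, 0))" for i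
  have lm_wt: "lm gt (gs ! i) = Some (wt i)" if "gs ! i \<noteq> 0" for i
    using that by (cases "lm gt (gs ! i)") (auto simp: wt_def lm_None_iff)
  have wt: "wt i \<in> MM" if "i < k" for i
    using lm_SomeD(2)[OF g[OF that]] s by (auto simp: wt_def split: option.split)
  let ?gtS = "schreyer_gt wt"
  interpret S: t_local_ordering m n k ?gtS gt0
    by (rule schreyer_ordering) (rule wt)
  have lin: "lincomb gs h = (\<Sum>l<k. h l \<odot> gs ! l)" for h
    by (simp add: lincomb_def k_def)
  define good where "good i j \<longleftrightarrow> i < j \<and> j < k \<and> gs ! i \<noteq> 0 \<and> gs ! j \<noteq> 0 \<and> snd (wt i) = snd (wt j)" for i j
  have "\<forall>i j. \<exists>\<sigma>. good i j \<longrightarrow> \<sigma> \<in> Rxs m n k \<and> lincomb gs \<sigma> = 0 \<and>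
      lm ?gtS \<sigma> = Some (mon_lcm (fst (wt i)) (fst (wt j)) - fst (wt i), i)"
    using spoly_syzygy[OF gs wt[unfolded k_def] lm_wt] spoly unfolding good_def k_def
    by (metis prod.collapse)
  then obtain \<sigma> where \<sigma>: "\<And>i j. good i j \<Longrightarrow> \<sigma> i j \<in> Rxs m n k"
      "\<And>i j. good i j \<Longrightarrow> lincomb gs (\<sigma> i j) = 0"
      "\<And>i j. good i j \<Longrightarrow> lm ?gtS (\<sigma> i j) = Some (mon_lcm (fst (wt i)) (fst (wt j)) - fst (wt i), i)"
    by metis
  define E where "E i = (\<lambda>l. if l = i then 1 else 0 :: 'k psp)" for i :: nat
  have E_coeff: "psv_coeff (E i) e = (if e = (0, i) then 1 else 0)" for i e
    by (cases e) (auto simp: psv_coeff.simps E_def)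
  have E: "E i \<in> Rxs m n k" "lm ?gtS (E i) = Some (0, i)" if "i < k" for i
  proof -
    show "E i \<in> Rxs m n k" using that by (auto simp: Rxs_iff E_coeff split: if_splits)
    then show "lm ?gtS (E i) = Some (0, i)"
      by (rule S.lm_eqI) (auto simp: E_coeff S.ge_def split: if_splits)
  qed
  have lin_E: "lincomb gs (E i) = 0" if "gs ! i = 0" for i
    unfolding lin by (rule sum.neutral) (use that in \<open>auto simp: E_def smult_vec_simps\<close>)
  define Sy where "Sy = (\<lambda>(i, j). \<sigma> i j) ` {(i, j). good i j} \<union> E ` {i. i < k \<and> gs ! i = 0}"
  have "finite {(i, j). good i j}"
    by (rule finite_subset[of _ "{..<k} \<times> {..<k}"]) (auto simp: good_def)
  then have "finite Sy" by (simp add: Sy_def)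
  then obtain ss where ss: "set ss = Sy" using finite_list by blast
  have Sy: "x \<in> Rxs m n k \<and> lincomb gs x = 0" if "x \<in> Sy" for x
    using that \<sigma>(1,2) E(1) lin_E by (auto simp: Sy_def)
  define h where "h l = (if l < k then q l else 0)" for l
  have hR: "h \<in> Rxs m n k" using q by (auto simp: Rxs_def h_def k_def)
  have lin_h: "lincomb gs h = u \<odot> f" unfolding eq lin h_def k_def by (intro sum.cong refl) simp
  have "set ss \<subseteq> Rxs m n k" using Sy ss by blast
  from S.weak_division_exists[OF hR this] obtain v a r where
    v: "v \<in> S_gt m n gt0" and rR: "r \<in> Rxs m n k"
    and vh: "v \<odot> h = (\<Sum>i<length ss. a i \<odot> ss ! i) + r"
    and red: "r \<noteq> 0 \<Longrightarrow> \<forall>i<length ss. \<not> lm_dvd (lm ?gtS (ss ! i)) (lm ?gtS r)"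
    unfolding weak_division_def by blast
  have red': "\<not> lm_dvd (lm ?gtS x) (lm ?gtS r)" if "x \<in> Sy" "r \<noteq> 0" for x
    using red[OF that(2)] that(1) unfolding ss[symmetric] by (auto simp: in_set_conv_nth)
  have "lincomb gs (ss ! i) = 0" if "i < length ss" for i
    using Sy[of "ss ! i"] nth_mem[OF that] ss by simp
  then have "lincomb gs (v \<odot> h) = lincomb gs r"
    unfolding vh lincomb_simps lincomb_sum by (simp add: smult_vec_simps)
  then have rep: "(v * u) \<odot> f = (\<Sum>l<k. r l \<odot> gs ! l)"
    unfolding lincomb_simps lin_h by (simp add: smult_vec_simps lin)
  have vu: "v * u \<in> S_gt m n gt0" using v u by (rule S_gt_mult)
  have rl: "r l \<in> Rx m n" if "l < k" for l using rR that by (auto simp: Rxs_def)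
  have "lm_le gt (lm gt (r l \<odot> gs ! l)) (lm gt f)" if l: "l < k" for l
  proof (cases "r = 0")
    case True
    then show ?thesis by (simp add: smult_vec_simps lm_def)
  next
    case False
    obtain P where "lm ?gtS r = Some P" using S.lm_exists[OF rR False] by blast
    then obtain p i where lmr: "lm ?gtS r = Some (p, i)" by (cases P) auto
    note R = S.lm_SomeD[OF rR lmr]
    have i: "i < k" "p \<in> M0" using R(2) by auto
    have gi: "gs ! i \<noteq> 0"
    proof
      assume "gs ! i = 0"
      then have "E i \<in> Sy" using i by (auto simp: Sy_def)
      moreover have "mmon_dvd (0, i) (p, i)" by (auto simp: mmon_dvd_def intro!: exI[of _ p])
      ultimately show False using red'[OF _ False, of "E i"] lmr E(2)[OF i(1)] by simp
    qed
    \<comment> \<open>\<open>W\<close> is the largest monomial produced by \<open>r\<close>. Were it also produced by an entry \<open>l \<noteq> i\<close>, the tie rule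
      would give \<open>i < l\<close>, and the leading monomial of the syzygy of \<open>i\<close> and \<open>l\<close> would divide that of \<open>r\<close>.\<close>
    define W where "W = mon_act p (wt i)"
    have WM: "W \<in> MM" using i wt by (simp add: W_def)
    have top: "lm gt (r i \<odot> gs ! i) = Some W"
      unfolding W_def
    proof (rule lm_smult(1)[OF rl[OF i(1)] _ _ g[OF i(1)] lm_wt[OF gi]])
      show "psp_coeff (r i) p \<noteq> 0" using R(3) by (simp add: psv_coeff.simps)
      fix y assume y: "psp_coeff (r i) y \<noteq> 0" "y \<noteq> p"
      then have "?gtS (p, i) (y, i)" using R(4)[of "(y, i)"] by (auto simp: psv_coeff.simps S.ge_def)
      moreover have "y \<in> M0" using rl[OF i(1)] y by (auto simp: Rx_iff)
      ultimately show "gt0 p y" using S.gt_gt0[OF i] by blast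
    qed
    note TOP = lm_SomeD[OF Rxs_smult[OF rl[OF i(1)] g[OF i(1)]] top]
    have less: "gt W w" if l: "l < k" "l \<noteq> i" and w: "psv_coeff (r l \<odot> gs ! l) w \<noteq> 0" for l w
    proof -
      obtain w0 c where wc: "w = (w0, c)" by (cases w)
      obtain x y where xy: "x + y = w0" "psp_coeff (r l) x \<noteq> 0" "psv_coeff (gs ! l) (y, c) \<noteq> 0"
        using w unfolding wc by (rule smult_coeff_nonzeroE)
      then have gl: "gs ! l \<noteq> 0" by auto
      have xM: "x \<in> M0" using rl[OF l(1)] xy by (auto simp: Rx_iff)
      have yM: "(y, c) \<in> MM" using g[OF l(1)] xy by (auto simp: Rxs_iff)
      have "ge (wt l) (y, c)" by (rule lm_SomeD(4)[OF g[OF l(1)] lm_wt[OF gl] xy(3)])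
      then have "ge (mon_act x (wt l)) (mon_act x (y, c))" by (rule ge_act[OF _ wt[OF l(1)] yM xM])
      then have 1: "ge (mon_act x (wt l)) w" using xy wc by simp
      have "?gtS (p, i) (x, l)"
        using R(4)[of "(x, l)"] xy l by (auto simp: psv_coeff.simps S.ge_def)
      moreover have "\<not> (mon_act p (wt i) = mon_act x (wt l) \<and> i < l)"
      proof
        assume *: "mon_act p (wt i) = mon_act x (wt l) \<and> i < l"
        then have eq: "p + fst (wt i) = x + fst (wt l)" "snd (wt i) = snd (wt l)"
          by (cases "wt i"; cases "wt l"; simp)+
        then have good: "good i l" using * l gi gl by (simp add: good_def)
        obtain z where "p = z + (mon_lcm (fst (wt i)) (fst (wt l)) - fst (wt i))"
          using mon_lcm_dvd[OF eq(1)] by blast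
        then have "lm_dvd (lm ?gtS (\<sigma> i l)) (lm ?gtS r)"
          unfolding \<sigma>(3)[OF good] lmr by (auto simp: mmon_dvd_def)
        moreover have "\<sigma> i l \<in> Sy" using good by (auto simp: Sy_def)
        ultimately show False using red' False by blast
      qed
      ultimately have "gt W (mon_act x (wt l))" by (auto simp: schreyer_gt_def W_def)
      then show ?thesis
        using gt_ge_trans[OF _ 1 WM] xM wt[OF l(1)] yM xy(1) wc by auto
    qed
    have geW: "ge W w" if "l < k" "psv_coeff (r l \<odot> gs ! l) w \<noteq> 0" for l w
      using less[OF that(1) _ that(2)] TOP(4) that(2) by (cases "l = i") (auto simp: ge_def)
    have fR: "(v * u) \<odot> f \<in> Rxs m n s" using S_gt_Rx[OF vu] f by (rule Rxs_smult)
    have "lm gt ((v * u) \<odot> f) = Some W"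
    proof (rule lm_eqI[OF fR])
      have z: "psv_coeff (r l \<odot> gs ! l) W = 0" if "l < k" "l \<noteq> i" for l
        using less[OF that, of W] gt_irrefl[OF WM] by blast
      have "psv_coeff ((v * u) \<odot> f) W = (\<Sum>l<k. psv_coeff (r l \<odot> gs ! l) W)"
        unfolding rep by simp
      also have "\<dots> = (\<Sum>l\<in>{i}. psv_coeff (r l \<odot> gs ! l) W)"
        by (rule sum.mono_neutral_right) (use i z in auto)
      finally show "psv_coeff ((v * u) \<odot> f) W \<noteq> 0" using TOP(3) by simp
      fix w assume "psv_coeff ((v * u) \<odot> f) w \<noteq> 0"
      then obtain l where "l < k" "psv_coeff (r l \<odot> gs ! l) w \<noteq> 0"
        unfolding rep psv_coeff_sum by (auto elim: sum.not_neutral_contains_not_neutral)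
      then show "ge W w" by (rule geW)
    qed
    then have "lm gt f = Some W" using lm_S_smult[OF vu f] by simp
    then show ?thesis
      using geW[OF l] by (simp add: lm_le_iff[OF Rxs_smult[OF rl[OF l] g[OF l]] WM])
  qed
  then have "weak_division m n s gt gt0 gs f (v * u) r 0"
    using vu rl rep unfolding weak_division_def k_def by auto
  then show ?thesis unfolding has_weak_standard_rep_def by blast
qed

end

section \<open>The equivalent characterisations of standard bases\<close>

theorem corollary4p6:
  fixes m n s :: nat
    and gt :: "mmon \<Rightarrow> mmon \<Rightarrow> bool"
    and gt0 :: "mon \<Rightarrow> mon \<Rightarrow> bool"
    and I :: "'k::field psv set"
    and gs :: "'k psv list"
  assumes "module_monomial_ordering m n s gt"
    and "induced_ordering m n s gt gt0"
    and "t_local m gt0"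
    and "I \<subseteq> Rxs m n s"
    and "submodule_over (Rx m n) I"
    and "set gs \<subseteq> I"
  shows "(standard_basis m n gt (set gs) I
            \<longleftrightarrow> (\<forall>f\<in>I. \<forall>r. weak_normal_form m n s gt gt0 gs f r \<longrightarrow> r = 0)) \<and>
         (standard_basis m n gt (set gs) I
            \<longleftrightarrow> (\<forall>f\<in>I. has_weak_standard_rep m n s gt gt0 gs f)) \<and>
         (standard_basis m n gt (set gs) I
            \<longleftrightarrow> loc_span m n gt0 I = loc_span m n gt0 (set gs) \<and>
                (\<forall>i j. i < j \<and> j < length gs \<longrightarrow>
                   has_weak_standard_rep m n s gt gt0 gs (spoly gt (gs ! i) (gs ! j))))"
    (is "(?a \<longleftrightarrow> ?b) \<and> (?a \<longleftrightarrow> ?c) \<and> (?a \<longleftrightarrow> ?d)")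
proof -
  interpret t_local_ordering m n s gt gt0 by unfold_locales (fact assms)+
  note I = assms(4) and sub = assms(5) and gsI = assms(6)
  have gs: "set gs \<subseteq> Rxs m n s" using I gsI by blast
  have nth: "gs ! i \<in> I" if "i < length gs" for i using gsI that by auto
  have a_iff: "?a \<longleftrightarrow> (\<forall>f\<in>I. f \<noteq> 0 \<longrightarrow> (\<exists>g\<in>set gs. lm_dvd (lm gt g) (lm gt f)))"
    by (rule standard_basis_iff[OF I _ gsI]) simp
  have "?a \<Longrightarrow> ?b"
  proof (intro ballI allI impI)
    fix f r assume a: ?a and f: "f \<in> I" and "weak_normal_form m n s gt gt0 gs f r"
    then obtain u q where u: "u \<in> S_gt m n gt0" and q: "\<And>i. i < length gs \<Longrightarrow> q i \<in> Rx m n"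
      and eq: "u \<odot> f = (\<Sum>i<length gs. q i \<odot> gs ! i) + r"
      and nd: "r \<noteq> 0 \<Longrightarrow> \<forall>i<length gs. \<not> lm_dvd (lm gt (gs ! i)) (lm gt r)"
      unfolding weak_normal_form_def weak_division_def by blast
    have "r = u \<odot> f - (\<Sum>i<length gs. q i \<odot> gs ! i)" using eq by simp
    also have "\<dots> \<in> I"
      using f nth q S_gt_Rx[OF u]
      by (intro submodule_diff[OF sub] submodule_sum[OF sub] submodule_smult[OF sub] Rx_uminus) auto
    finally have "r \<in> I" .
    show "r = 0"
    proof (rule ccontr)
      assume "r \<noteq> 0"
      then obtain g where "g \<in> set gs" "lm_dvd (lm gt g) (lm gt r)"
        using a \<open>r \<in> I\<close> unfolding a_iff by blast
      then show False using nd[OF \<open>r \<noteq> 0\<close>] by (auto simp: in_set_conv_nth)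
    qed
  qed
  moreover have "?b \<Longrightarrow> ?c"
  proof
    fix f assume b: ?b and f: "f \<in> I"
    then obtain u q r where d: "weak_division m n s gt gt0 gs f u q r"
      using weak_division_exists[of f gs] I gs by blast
    then have "r = 0" using b f by (auto simp: weak_normal_form_def)
    then show "has_weak_standard_rep m n s gt gt0 gs f" using d by (auto simp: has_weak_standard_rep_def)
  qed
  moreover have "?c \<Longrightarrow> ?a"
    unfolding a_iff using weak_standard_rep_lm_dvd[OF _ _ gs] I by blast
  moreover have "?c \<Longrightarrow> ?d"
  proof (intro conjI allI impI)
    assume c: ?c
    have "fract_vec ` I \<subseteq> loc_span m n gt0 (set gs)"
    proof (rule image_subsetI)
      fix f assume "f \<in> I"
      then obtain u q where "u \<in> S_gt m n gt0" "\<And>i. i < length gs \<Longrightarrow> q i \<in> Rx m n"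
        "u \<odot> f = (\<Sum>i<length gs. q i \<odot> gs ! i)"
        using c unfolding has_weak_standard_rep_def weak_division_def by force
      then show "fract_vec f \<in> loc_span m n gt0 (set gs)" by (rule loc_span_memI)
    qed
    then have "loc_span m n gt0 I \<subseteq> loc_span m n gt0 (set gs)"
      unfolding loc_span_def[of m n gt0 I] by (rule hull_minimal) (simp add: loc_span_def submodule_hull)
    moreover have "loc_span m n gt0 (set gs) \<subseteq> loc_span m n gt0 I"
      unfolding loc_span_def by (intro hull_mono image_mono gsI)
    ultimately show "loc_span m n gt0 I = loc_span m n gt0 (set gs)" by blast
    fix i j assume "i < j \<and> j < length gs"
    then show "has_weak_standard_rep m n s gt gt0 gs (spoly gt (gs ! i) (gs ! j))"
      using c spoly_in_submodule[OF I sub nth nth] by auto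
  qed
  moreover have "?d \<Longrightarrow> ?c"
  proof
    fix f assume d: ?d and f: "f \<in> I"
    have "fract_vec f \<in> loc_span m n gt0 I" unfolding loc_span_def using f by (intro hull_inc) auto
    then have "fract_vec f \<in> loc_span m n gt0 (set gs)" using d by simp
    from loc_span_memD[OF this] obtain u q where u: "u \<in> S_gt m n gt0"
      and q: "\<And>i. i < length gs \<Longrightarrow> q i \<in> Rx m n" and eq: "u \<odot> f = (\<Sum>i<length gs. q i \<odot> gs ! i)"
      by blast
    show "has_weak_standard_rep m n s gt gt0 gs f"
    proof (rule buchberger_criterion[OF gs _ _ u q eq])
      show "f \<in> Rxs m n s" using f I by blast
    qed (use d in auto)
  qed
  ultimately show ?thesis by blast
qed

end
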